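(* Let $r>1$ be a fixed real number and $n\ge 2$ an integer. Let $S_1,S_2$ be sets of primes such that for some constants $\delta_1,\delta_2>0$ and $c>0$ and $j=1,2$, $$\pi_{S_j}(x):=\sum_{p\le x,\ p\in S_j}1=\frac{1}{\delta_j}\mathrm{Li}(x)+\mathcal{O}\left(xe^{-c\sqrt{\log x}}\right).$$ Let $D_r(x):=\#\{pq\le x:\ p<q\le rp,\ p\in S_1,\ q\in S_2\}$ ($p,q$ primes), let $0<\epsilon<1$ and $c(\epsilon)=(1-\epsilon)c/\sqrt{2}$, and let $$a_k(r)=\sum_{j=1}^{\lfloor (k+1)/2\rfloor}\frac{k!}{(2j-1)!}\cdot\frac{2\log^{2j-1}r}{2j-1}.$$ Then, as $x\to\infty$, $$\delta_1\delta_2D_r(x)=\sum_{k=1}^{n-1}a_k(r)\frac{x}{\log^{k+1}x}+\mathcal{O}\left(rxe^{-c(\epsilon)\sqrt{\log x}}\right)+\mathcal{O}_n\left(\frac{x\log^{2\lfloor n/2\rfloor+1}(2r)\log r}{\log^{n+1}x}\right).$$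
   Context: $\mathrm{Li}(x)=\int_2^x dt/\log t$. The first implied constant may depend on $S_1,S_2,\epsilon$; the second depends only on $n$. *)

theory Defs
  imports
    "HOL-Analysis.Analysis"
    "HOL-Library.Landau_Symbols"
    "HOL-Computational_Algebra.Primes"
begin

definition Li :: "real \<Rightarrow> real" where
  "Li x = integral {2..x} (\<lambda>t. 1 / ln t)"

definition prime_count :: "nat set \<Rightarrow> real \<Rightarrow> nat" where
  "prime_count S x = card {p \<in> S. prime p \<and> real p \<le> x}"

definition D_count :: "nat set \<Rightarrow> nat set \<Rightarrow> real \<Rightarrow> real \<Rightarrow> nat" where
  "D_count S1 S2 r x = card {p * q | p q. prime p \<and> prime q \<and> p \<in> S1 \<and> q \<in> S2 \<and>
     p < q \<and> real q \<le> r * real p \<and> real (p * q) \<le> x}"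

definition a_coeff :: "nat \<Rightarrow> real \<Rightarrow> real" where
  "a_coeff k r = (\<Sum>j = 1..(k + 1) div 2.
     fact k / fact (2 * j - 1) * (2 * ln r ^ (2 * j - 1) / real (2 * j - 1)))"

end

theory Submission
  imports Defs "HOL-Real_Asymp.Real_Asymp"
begin

text \<open>
  Write \<open>L = ln r\<close> and \<open>a = (1 - \<epsilon>) * c / sqrt 2\<close>. If \<open>r \<ge> exp (a * sqrt (ln x))\<close>, the first error
  term dominates everything. Otherwise, counting the \<open>q\<close> belonging to each \<open>p \<le> sqrt x\<close> and
  replacing \<open>\<pi>\<close> by \<open>Li\<close> turns \<open>D\<close> into a sum over \<open>p \<in> S1\<close> of
  \<open>Li (min (r * p) (x / p)) - Li p\<close>. As an integral over the product \<open>w = p * u\<close> this is the integral of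
  \<open>J w = (\<Sum>p. 1 / (p * (ln w - ln p)))\<close>, where \<open>p\<^sup>2 \<le> w < r * p\<^sup>2\<close>. Partial summation
  approximates \<open>\<delta>1 * J w\<close> by the integral of \<open>1 / (t * ln t * (ln w - ln t))\<close> over
  \<open>sqrt (w / r) \<le> t \<le> sqrt w\<close>, which is \<open>(ln (ln w + L) - ln (ln w - L)) / ln w\<close>. Its expansion in
  powers of \<open>L / ln w\<close> agrees up to order \<open>n\<close> with the derivative of the claimed main term, because
  \<open>a_k - k * a_{k-1}\<close> equals \<open>2 * L ^ k / k\<close> for odd \<open>k\<close> and vanishes for even \<open>k\<close>.
\<close>

section \<open>The logarithmic integral\<close>

text \<open>The derivative is taken within the interval because at 2 only the right-hand one exists:
  to the left of 2 the integral runs over an empty interval and \<open>Li\<close> is 0.\<close>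

lemma Li_has_real_derivative:
  assumes "2 \<le> a" "t \<in> {a..b}"
  shows "(Li has_real_derivative 1 / ln t) (at t within {a..b})"
proof -
  have "continuous_on {2..b} (\<lambda>t::real. 1 / ln t)"
    by (intro continuous_intros) auto
  then have "((\<lambda>x. integral {2..x} (\<lambda>t. 1 / ln t)) has_real_derivative 1 / ln t) (at t within {2..b})"
    using integral_has_real_derivative assms by fastforce
  then have "(Li has_real_derivative 1 / ln t) (at t within {2..b})"
    unfolding Li_def [abs_def] .
  then show ?thesis
    by (rule DERIV_subset) (use assms in auto)
qed

lemma ln_2_ge_half: "1 / 2 \<le> ln (2::real)"
  using ln_add_one_self_le_self2[of "-1/2"] by (simp add: ln_div)

lemma Li_bounds:
  assumes "2 \<le> y"
  shows "0 \<le> Li y" "Li y \<le> 2 * y"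
proof -
  have I: "((\<lambda>t. 1 / ln t) has_integral (Li y - Li 2)) {2..y}"
    by (rule fundamental_theorem_of_calculus)
       (use assms in \<open>auto intro!: Li_has_real_derivative simp flip: has_real_derivative_iff_has_vector_derivative\<close>)
  have Li2: "Li 2 = 0" by (simp add: Li_def)
  have c: "((\<lambda>t. k) has_integral k * (y - 2)) {2..y}" for k :: real
    using has_integral_const_real[of k 2 y] assms by (simp add: mult.commute)
  have "1 / ln t \<le> 2" if "t \<in> {2..y}" for t
  proof -
    have "1 / 2 \<le> ln t" using ln_2_ge_half ln_le_cancel_iff[of 2 t] that by (simp del: ln_le_cancel_iff)
    then have "1 / ln t \<le> 1 / (1/2)" by (intro divide_left_mono) auto
    then show ?thesis by simp
  qed
  then have "Li y - Li 2 \<le> 2 * (y - 2)" by (intro has_integral_le[OF I c]) 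
  then show "Li y \<le> 2 * y" using Li2 by simp
  have "0 * (y - 2) \<le> Li y - Li 2"
    by (rule has_integral_le[OF c I]) auto
  then show "0 \<le> Li y" using Li2 by simp
qed

section \<open>The error function\<close>

text \<open>The rate is a parameter because three of them occur: \<open>c\<close> for the prime
  counts, \<open>c / sqrt 2\<close> once arguments near \<open>sqrt x\<close> are involved, and the
  slightly smaller rate of the final bound.\<close>

definition damped :: "real \<Rightarrow> real \<Rightarrow> real" where
  "damped c y = y * exp (- c * sqrt (ln y))"

lemma damped_pos: "0 < y \<Longrightarrow> 0 < damped c y"
  by (simp add: damped_def)

text \<open>Evaluating at 2, where \<open>damped\<close> is positive, recovers the sign of
  \<open>K\<close> wherever an error bound is assumed.\<close>

lemma damped_bound_nonneg:
  assumes "\<And>y. 2 \<le> y \<Longrightarrow> \<bar>f y\<bar> \<le> K * damped c y"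
  shows "0 \<le> K"
proof -
  have "0 \<le> K * damped c 2" using assms[of 2] by linarith
  then show ?thesis using damped_pos[of 2 c] by (simp add: zero_le_mult_iff)
qed

text \<open>With \<open>u = sqrt (ln y)\<close> and \<open>v = sqrt (ln z)\<close>, the logarithm of the quotient is
  \<open>(v - u) * (v + u - c) \<ge> (v - u) * (v - u - c) \<ge> - c\<^sup>2 / 4\<close>.\<close>

lemma damped_quasi_mono:
  assumes "1 \<le> y" "y \<le> z"
  shows "damped c y \<le> exp (c\<^sup>2 / 4) * damped c z"
proof -
  define u v where "u = sqrt (ln y)" and "v = sqrt (ln z)"
  have uv: "0 \<le> u" "u \<le> v" using assms by (auto simp: u_def v_def)
  have y: "y = exp (u\<^sup>2)" and z: "z = exp (v\<^sup>2)"
    using assms by (auto simp: u_def v_def)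
  have "0 \<le> (v - u - c / 2)\<^sup>2 + 2 * u * (v - u)" using uv by simp
  then have "u\<^sup>2 - c * u \<le> c\<^sup>2 / 4 + (v\<^sup>2 - c * v)"
    by (simp add: power2_eq_square algebra_simps)
  then have "exp (u\<^sup>2 - c * u) \<le> exp (c\<^sup>2 / 4 + (v\<^sup>2 - c * v))" by simp
  moreover have "damped c y = exp (u\<^sup>2 - c * u)" "damped c z = exp (v\<^sup>2 - c * v)"
    using y z by (simp_all add: damped_def u_def v_def exp_diff exp_minus field_simps)
  ultimately show ?thesis by (simp add: exp_add)
qed

text \<open>Since \<open>damped c 1 = 1\<close>, quasi-monotonicity from 1 lets constants be
  absorbed into the error term.\<close>

lemma damped_ge:
  assumes "1 \<le> y"
  shows "1 \<le> exp (c\<^sup>2 / 4) * damped c y"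
  using damped_quasi_mono[of 1 y c] assms by (simp add: damped_def)

lemma damped_scale:
  assumes "1 \<le> y" "1 \<le> s" "0 \<le> c"
  shows "damped c (s * y) \<le> s * damped c y"
proof -
  have "ln y \<le> ln (s * y)" using assms by (subst ln_le_cancel_iff) auto
  then show ?thesis using assms unfolding damped_def
    by (auto intro!: mult_left_mono mult_right_mono simp: mult.assoc)
qed

section \<open>Prime counts with explicit error\<close>

lemma le_sqrt_iff: "0 \<le> y \<Longrightarrow> y \<le> sqrt u \<longleftrightarrow> y\<^sup>2 \<le> u"
  using real_sqrt_le_iff[of "y\<^sup>2" u] by (simp del: real_sqrt_le_iff)

lemma prime_count_le:
  assumes "0 \<le> y"
  shows "real (prime_count S y) \<le> y"
proof -
  have "{p \<in> S. prime p \<and> real p \<le> y} \<subseteq> {1..nat \<lfloor>y\<rfloor>}"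
    using assms by (auto simp: le_nat_floor prime_ge_Suc_0_nat)
  from card_mono[OF _ this] have "prime_count S y \<le> nat \<lfloor>y\<rfloor>"
    by (simp add: prime_count_def)
  then have "real (prime_count S y) \<le> real (nat \<lfloor>y\<rfloor>)" by simp
  also have "\<dots> \<le> y" using assms by (simp add: of_nat_floor)
  finally show ?thesis .
qed

text \<open>Makes the Landau bound explicit on the whole range \<open>y \<ge> 2\<close>. Below the
  threshold \<open>y0\<close> the trivial bounds for \<open>prime_count\<close> and
  \<open>Li\<close> bound the error by the constant \<open>B\<close>, which \<open>damped_ge\<close>
  absorbs.\<close>

lemma prime_count_error_bound:
  assumes "(\<lambda>x. real (prime_count S x) - d * Li x) \<in> O(\<lambda>x. x * exp (- c * sqrt (ln x)))"
  obtains K where "0 < K" "\<And>y. 2 \<le> y \<Longrightarrow> \<bar>real (prime_count S y) - d * Li y\<bar> \<le> K * damped c y"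
proof -
  obtain K0 where K0: "0 < K0"
    "\<forall>\<^sub>F x in at_top. \<bar>real (prime_count S x) - d * Li x\<bar> \<le> K0 * \<bar>x * exp (- c * sqrt (ln x))\<bar>"
    using assms by (elim landau_o.bigE) auto
  then obtain y0 where y0: "\<And>x. y0 \<le> x \<Longrightarrow>
      \<bar>real (prime_count S x) - d * Li x\<bar> \<le> K0 * \<bar>x * exp (- c * sqrt (ln x))\<bar>"
    by (auto simp: eventually_at_top_linorder)
  define B where "B = (1 + 2 * \<bar>d\<bar>) * \<bar>y0\<bar>"
  show ?thesis
  proof (rule that[of "K0 + B * exp (c\<^sup>2 / 4)"])
    show "0 < K0 + B * exp (c\<^sup>2 / 4)" using K0(1)
      by (intro add_pos_nonneg) (auto simp: B_def)
    fix y :: real assume y: "2 \<le> y"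
    have pos: "0 < damped c y" using y by (intro damped_pos) auto
    show "\<bar>real (prime_count S y) - d * Li y\<bar> \<le> (K0 + B * exp (c\<^sup>2 / 4)) * damped c y"
    proof (cases "y0 \<le> y")
      case True
      have "\<bar>real (prime_count S y) - d * Li y\<bar> \<le> K0 * damped c y"
        using y0[OF True] y by (simp add: damped_def abs_mult)
      also have "\<dots> \<le> (K0 + B * exp (c\<^sup>2 / 4)) * damped c y"
        using pos by (intro mult_right_mono) (auto simp: B_def)
      finally show ?thesis .
    next
      case False
      have "\<bar>real (prime_count S y) - d * Li y\<bar> \<le> real (prime_count S y) + \<bar>d\<bar> * \<bar>Li y\<bar>"
        unfolding abs_mult [symmetric] by linarith
      also have "\<dots> \<le> y + \<bar>d\<bar> * (2 * y)"
        using prime_count_le[of y S] Li_bounds[OF y] y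
        by (intro add_mono mult_left_mono) auto
      also have "\<dots> = (1 + 2 * \<bar>d\<bar>) * y" by (simp add: algebra_simps)
      also have "\<dots> \<le> B * 1"
        unfolding B_def using False y by (simp add: mult_left_mono)
      also have "\<dots> \<le> B * (exp (c\<^sup>2 / 4) * damped c y)"
        using damped_ge[of y c] y by (intro mult_left_mono) (auto simp: B_def)
      also have "\<dots> \<le> (K0 + B * exp (c\<^sup>2 / 4)) * damped c y"
        using K0(1) pos by (simp add: algebra_simps)
      finally show ?thesis .
    qed
  qed
qed

lemma prime_count_diff:
  assumes "a \<le> t"
  shows "real (prime_count S t) - real (prime_count S a) = card {p \<in> S. prime p \<and> a < real p \<and> real p \<le> t}"
proof -
  have fin: "finite {p \<in> S. prime p \<and> P p \<and> real p \<le> t}" for P t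
    by (rule finite_subset[of _ "{..nat \<lfloor>t\<rfloor>}"]) (auto simp: le_nat_floor)
  have "{p \<in> S. prime p \<and> real p \<le> t} = {p \<in> S. prime p \<and> real p \<le> a} \<union> {p \<in> S. prime p \<and> a < real p \<and> real p \<le> t}"
    using assms by auto
  moreover have "card ({p \<in> S. prime p \<and> real p \<le> a} \<union> {p \<in> S. prime p \<and> a < real p \<and> real p \<le> t})
      = card {p \<in> S. prime p \<and> real p \<le> a} + card {p \<in> S. prime p \<and> a < real p \<and> real p \<le> t}"
    using fin[of "\<lambda>_. True"] fin by (intro card_Un_disjoint) auto
  ultimately show ?thesis by (simp add: prime_count_def)
qed

section \<open>Partial summation over primes\<close>

text \<open>With \<open>E\<close> the error of the prime count, the difference equals
  \<open>E b * \<phi> b - E a * \<phi> a\<close> plus the integral of \<open>- \<phi>' * E\<close>.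
  As \<open>\<phi>\<close> is decreasing and nonnegative, the three parts are at most
  \<open>M * \<phi> b\<close>, \<open>M * \<phi> a\<close> and
  \<open>M * (\<phi> a - \<phi> b)\<close>, with sum \<open>2 * M * \<phi> a\<close>.\<close>

lemma partial_summation_bound:
  fixes \<phi> \<phi>' :: "real \<Rightarrow> real"
  assumes ab: "2 \<le> a" "a \<le> b"
    and deriv: "\<And>t. t \<in> {a..b} \<Longrightarrow> (\<phi> has_real_derivative \<phi>' t) (at t within {a..b})"
    and decr: "\<And>t. t \<in> {a..b} \<Longrightarrow> \<phi>' t \<le> 0" and nonneg: "0 \<le> \<phi> b"
    and H: "((\<lambda>t. \<phi> t / ln t) has_integral H) {a..b}"
    and M: "\<And>t. t \<in> {a..b} \<Longrightarrow> \<bar>real (prime_count S t) - d * Li t\<bar> \<le> M"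
  shows "\<bar>(\<Sum>p | p \<in> S \<and> prime p \<and> a < real p \<and> real p \<le> b. \<phi> (real p)) - d * H\<bar> \<le> 2 * M * \<phi> a"
proof -
  define P where "P = {p. p \<in> S \<and> prime p \<and> a < real p \<and> real p \<le> b}"
  define E where "E t = real (prime_count S t) - d * Li t" for t
  have finP: "finite P"
    by (rule finite_subset[of _ "{..nat \<lfloor>b\<rfloor>}"]) (auto simp: P_def le_nat_floor)
  have ftc: "((\<lambda>t. - \<phi>' t) has_integral (\<phi> u - \<phi> b)) {u..b}" if "u \<in> {a..b}" for u
  proof -
    have "((\<lambda>t. - \<phi>' t) has_integral (- \<phi> b - - \<phi> u)) {u..b}"
      using that
      by (intro fundamental_theorem_of_calculus)
         (auto simp flip: has_real_derivative_iff_has_vector_derivative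
            intro!: derivative_eq_intros DERIV_subset[OF deriv])
    then show ?thesis by simp
  qed
  \<comment> \<open>Each \<open>\<phi> p - \<phi> b\<close> is the integral of
    \<open>- \<phi>'\<close> over \<open>{p..b}\<close>. After exchanging sum and integral, the
    integrand counts the primes between \<open>a\<close> and \<open>t\<close>.\<close>
  have "((\<lambda>t. \<Sum>p\<in>P. if t \<in> {real p..b} then - \<phi>' t else 0) has_integral (\<Sum>p\<in>P. \<phi> p - \<phi> b)) {a..b}"
    by (intro has_integral_sum finP, subst has_integral_restrict) (auto simp: P_def intro!: ftc)
  also have "(\<Sum>p\<in>P. \<phi> p - \<phi> b) = (\<Sum>p\<in>P. \<phi> p) - (real (prime_count S b) - real (prime_count S a)) * \<phi> b"
    using prime_count_diff[OF ab(2), of S] by (simp add: sum_subtractf P_def)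
  finally have 1: "((\<lambda>t. \<Sum>p\<in>P. if t \<in> {real p..b} then - \<phi>' t else 0) has_integral \<dots>) {a..b}" .
  have eq: "(\<Sum>p\<in>P. if t \<in> {real p..b} then - \<phi>' t else 0)
      = - \<phi>' t * (real (prime_count S t) - real (prime_count S a))" if "t \<in> {a..b}" for t
  proof -
    have "(\<Sum>p\<in>P. if t \<in> {real p..b} then - \<phi>' t else 0)
        = (\<Sum>p\<in>{p\<in>P. t \<in> {real p..b}}. - \<phi>' t)"
      using finP by (subst sum.inter_filter) auto
    also have "{p\<in>P. t \<in> {real p..b}} = {p \<in> S. prime p \<and> a < real p \<and> real p \<le> t}"
      using that by (auto simp: P_def)
    also have "(\<Sum>p\<in>\<dots>. - \<phi>' t) = - \<phi>' t * (real (prime_count S t) - real (prime_count S a))"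
      using that by (subst prime_count_diff) auto
    finally show ?thesis .
  qed
  have 1: "((\<lambda>t. - \<phi>' t * (real (prime_count S t) - real (prime_count S a))) has_integral
      (\<Sum>p\<in>P. \<phi> p) - (real (prime_count S b) - real (prime_count S a)) * \<phi> b) {a..b}"
    using has_integral_eq[OF eq 1] .
  \<comment> \<open>Integration by parts for the \<open>Li\<close> side: the product rule for
    \<open>\<phi> * Li\<close>.\<close>
  have 2: "((\<lambda>t. \<phi>' t * Li t + \<phi> t / ln t) has_integral (\<phi> b * Li b - \<phi> a * Li a)) {a..b}"
    using ab
    by (intro fundamental_theorem_of_calculus)
       (auto simp flip: has_real_derivative_iff_has_vector_derivative
            intro!: derivative_eq_intros deriv Li_has_real_derivative)
  \<comment> \<open>The coefficients are chosen so that the terms with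
    \<open>prime_count S a\<close> cancel and the integrand collapses to
    \<open>- \<phi>' * E\<close>.\<close>
  have "((\<lambda>t. - \<phi>' t * (real (prime_count S t) - real (prime_count S a)) 
         + real (prime_count S a) * (- \<phi>' t) + d * (\<phi>' t * Li t + \<phi> t / ln t - \<phi> t / ln t)) has_integral
      (\<Sum>p\<in>P. \<phi> p) - (real (prime_count S b) - real (prime_count S a)) * \<phi> b
         + real (prime_count S a) * (\<phi> a - \<phi> b) + d * ((\<phi> b * Li b - \<phi> a * Li a) - H)) {a..b}"
    by (intro has_integral_add has_integral_mult_right has_integral_diff 1 2 H ftc) (use ab in auto)
  also have "(\<lambda>t. - \<phi>' t * (real (prime_count S t) - real (prime_count S a)) 
         + real (prime_count S a) * (- \<phi>' t) + d * (\<phi>' t * Li t + \<phi> t / ln t - \<phi> t / ln t)) = (\<lambda>t. - \<phi>' t * E t)"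
    by (auto simp: E_def algebra_simps)
  also have "(\<Sum>p\<in>P. \<phi> p) - (real (prime_count S b) - real (prime_count S a)) * \<phi> b
         + real (prime_count S a) * (\<phi> a - \<phi> b) + d * ((\<phi> b * Li b - \<phi> a * Li a) - H)
     = (\<Sum>p\<in>P. \<phi> p) - d * H - E b * \<phi> b + E a * \<phi> a" (is "_ = ?V")
    by (simp add: E_def algebra_simps)
  finally have V: "((\<lambda>t. - \<phi>' t * E t) has_integral ?V) {a..b}" .
  have "?V \<le> (\<phi> a - \<phi> b) * M"
  proof (rule has_integral_le[OF V has_integral_mult_left[OF ftc]])
    fix t assume t: "t \<in> {a..b}"
    show "- \<phi>' t * E t \<le> - \<phi>' t * M"
      using M[OF t] decr[OF t] by (intro mult_left_mono) (auto simp: E_def)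
  qed (use ab in auto)
  moreover have "(\<phi> a - \<phi> b) * (-M) \<le> ?V"
  proof (rule has_integral_le[OF has_integral_mult_left[OF ftc] V])
    fix t assume t: "t \<in> {a..b}"
    show "- \<phi>' t * (-M) \<le> - \<phi>' t * E t"
      using M[OF t] decr[OF t] by (intro mult_left_mono) (auto simp: E_def)
  qed (use ab in auto)
  ultimately have V1: "\<bar>?V\<bar> \<le> (\<phi> a - \<phi> b) * M" by (auto simp: abs_le_iff)
  have "0 \<le> \<phi> a - \<phi> b"
    by (rule has_integral_nonneg[OF ftc]) (use ab decr in auto)
  then have phia: "0 \<le> \<phi> a" using nonneg by simp
  have "\<bar>E b * \<phi> b\<bar> \<le> M * \<phi> b" "\<bar>E a * \<phi> a\<bar> \<le> M * \<phi> a"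
    using M[of b] M[of a] ab nonneg phia by (auto simp: abs_mult E_def intro!: mult_right_mono)
  then have "\<bar>(\<Sum>p\<in>P. \<phi> p) - d * H\<bar> \<le> 2 * M * \<phi> a"
    using V1 by (simp add: left_diff_distrib mult.commute[of M] mult.assoc)
  then show ?thesis by (simp add: P_def)
qed

section \<open>From the sum over primes to the logarithmic kernel\<close>

definition log_kernel :: "real \<Rightarrow> real \<Rightarrow> real" where
  "log_kernel r w = (ln (ln w + ln r) - ln (ln w - ln r)) / ln w"

text \<open>Partial summation with \<open>\<phi> t = 1 / (t * (ln w - ln t))\<close> from
  \<open>sqrt (w / r)\<close> to \<open>sqrt w\<close>; \<open>4 * r \<le> w\<close> keeps the lower
  end at 2 or more. \<open>M\<close> is of size \<open>damped c (sqrt w)\<close> and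
  \<open>\<phi>\<close> is at most \<open>sqrt r / sqrt w\<close>, so \<open>sqrt w\<close> cancels,
  and \<open>ln (sqrt w) = ln w / 2\<close> turns the rate \<open>c\<close> into
  \<open>c / sqrt 2\<close>.\<close>

lemma kernel_sum_bound:
  assumes r: "1 < r" and w: "4 * r \<le> w" "2 \<le> ln w" and c: "0 \<le> c"
    and E: "\<And>y. 2 \<le> y \<Longrightarrow> \<bar>real (prime_count S y) - d * Li y\<bar> \<le> K * damped c y"
  shows "\<bar>(\<Sum>p | p \<in> S \<and> prime p \<and> real p ^ 2 \<le> w \<and> w < r * real p ^ 2. 1 / (p * (ln w - ln p))) - d * log_kernel r w\<bar>
    \<le> 2 * K * exp (c\<^sup>2 / 4) * sqrt r * exp (- (c / sqrt 2) * sqrt (ln w))"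
proof -
  define X where "X = ln w"
  define L where "L = ln r"
  define a where "a = sqrt (w / r)"
  define b where "b = sqrt w"
  define \<phi> where "\<phi> t = 1 / (t * (X - ln t))" for t
  define \<phi>' where "\<phi>' t = - (X - ln t - 1) / (t * (X - ln t))\<^sup>2" for t
  define M where "M = K * exp (c\<^sup>2 / 4) * damped c b"
  have w0: "4 < w" using r w by linarith
  have L0: "0 < L" using r by (simp add: L_def)
  have X2: "2 \<le> X" using w by (simp add: X_def)
  have K: "0 \<le> K" using E by (rule damped_bound_nonneg)
  have a2: "2 \<le> a" unfolding a_def using w r by (intro real_le_rsqrt) (simp add: field_simps)
  have ab: "a \<le> b" unfolding a_def b_def using w0 r by (simp add: field_simps)
  have lnb: "ln b = X / 2" using w0 by (simp add: b_def X_def ln_sqrt)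
  have lna: "ln a = (X - L) / 2" using w0 r by (simp add: a_def X_def L_def ln_sqrt ln_div)
  have lna0: "0 < ln a" using a2 by simp
  have t_facts: "0 < t" "0 < ln t" "ln t \<le> X / 2" if "t \<in> {a..b}" for t
  proof -
    show "0 < t" "0 < ln t" using that a2 by auto
    have "ln t \<le> ln b" using that a2 by (subst ln_le_cancel_iff) auto
    then show "ln t \<le> X / 2" using lnb by simp
  qed
  \<comment> \<open>The antiderivative comes from partial fractions:
    \<open>1 / (s * (X - s)) = (1 / s + 1 / (X - s)) / X\<close> with
    \<open>s = ln t\<close>.\<close>
  have H: "((\<lambda>t. \<phi> t / ln t) has_integral (ln (ln b) - ln (X - ln b)) / X - (ln (ln a) - ln (X - ln a)) / X) {a..b}"
  proof (rule fundamental_theorem_of_calculus[OF ab])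
    fix t assume t: "t \<in> {a..b}"
    note t' = t_facts[OF t]
    have "X - ln t \<noteq> 0" using t' X2 by linarith
    then have "((\<lambda>t. (ln (ln t) - ln (X - ln t)) / X) has_real_derivative \<phi> t / ln t) (at t within {a..b})"
      using t' X2 unfolding \<phi>_def
      by (auto intro!: derivative_eq_intros simp: divide_simps)
    then show "((\<lambda>t. (ln (ln t) - ln (X - ln t)) / X) has_vector_derivative \<phi> t / ln t) (at t within {a..b})"
      by (simp add: has_real_derivative_iff_has_vector_derivative)
  qed
  \<comment> \<open>The upper end contributes 0, as \<open>ln b = X - ln b\<close>. At the lower end
    the factors 1/2 in \<open>(X + L) / 2\<close> and \<open>(X - L) / 2\<close> cancel.\<close>
  have "(ln (ln b) - ln (X - ln b)) / X - (ln (ln a) - ln (X - ln a)) / X = log_kernel r w"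
  proof -
    have "X - ln a = (X + L) / 2" unfolding lna by (simp add: field_simps)
    moreover have "0 < X - L" using lna lna0 by simp
    moreover have "X - X / 2 = X / 2" by simp
    ultimately show ?thesis using L0 X2 unfolding log_kernel_def lnb lna X_def[symmetric] L_def[symmetric]
      by (simp only: ln_div) (simp add: ln_div minus_divide_left flip: diff_divide_distrib)
  qed
  with H have H: "((\<lambda>t. \<phi> t / ln t) has_integral log_kernel r w) {a..b}" by simp
  have "\<bar>(\<Sum>p | p \<in> S \<and> prime p \<and> a < real p \<and> real p \<le> b. \<phi> (real p)) - d * log_kernel r w\<bar> \<le> 2 * M * \<phi> a"
  proof (rule partial_summation_bound[OF a2 ab _ _ _ H])
    fix t assume t: "t \<in> {a..b}"
    note t' = t_facts[OF t]
    have "X - ln t \<noteq> 0" using t' X2 by linarith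
    then show "(\<phi> has_real_derivative \<phi>' t) (at t within {a..b})"
      using t' X2 unfolding \<phi>_def [abs_def] \<phi>'_def
      by (auto intro!: derivative_eq_intros simp: power2_eq_square)
    \<comment> \<open>The numerator has the right sign because
      \<open>X - ln t \<ge> X / 2 \<ge> 1\<close>.\<close>
    show "\<phi>' t \<le> 0" using t' X2 unfolding \<phi>'_def by (intro divide_nonpos_nonneg) auto
    have "\<bar>real (prime_count S t) - d * Li t\<bar> \<le> K * damped c t"
      using t a2 by (intro E) auto
    also have "\<dots> \<le> K * (exp (c\<^sup>2 / 4) * damped c b)"
      using t a2 K by (intro mult_left_mono damped_quasi_mono) auto
    finally show "\<bar>real (prime_count S t) - d * Li t\<bar> \<le> M" by (simp add: M_def mult.assoc)
  next
    show "0 \<le> \<phi> b" using lnb X2 w0 by (simp add: \<phi>_def b_def)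
  qed
  also have "2 * M * \<phi> a \<le> 2 * M * (sqrt r / b)"
  proof (rule mult_left_mono)
    have "1 \<le> X - ln a" using t_facts(3)[of a] ab X2 by auto
    then have "a * 1 \<le> a * (X - ln a)" using a2 by (intro mult_left_mono) auto
    then have "\<phi> a \<le> 1 / a" unfolding \<phi>_def using a2 by (intro divide_left_mono) auto
    also have "1 / a = sqrt r / b" by (simp add: a_def b_def real_sqrt_divide)
    finally show "\<phi> a \<le> sqrt r / b" .
    show "0 \<le> 2 * M" using K a2 ab damped_pos[of b c] by (simp add: M_def)
  qed
  also have "damped c b = b * exp (- (c / sqrt 2) * sqrt X)"
    unfolding damped_def lnb by (simp add: real_sqrt_divide)
  then have "2 * M * (sqrt r / b) = 2 * K * exp (c\<^sup>2 / 4) * sqrt r * exp (- (c / sqrt 2) * sqrt X)"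
    using a2 ab by (simp add: M_def)
  also have "{p. p \<in> S \<and> prime p \<and> a < real p \<and> real p \<le> b} = {p. p \<in> S \<and> prime p \<and> real p ^ 2 \<le> w \<and> w < r * real p ^ 2}"
  proof -
    have "a < real p \<longleftrightarrow> w < r * real p ^ 2" "real p \<le> b \<longleftrightarrow> real p ^ 2 \<le> w" for p
    proof -
      have "a < real p \<longleftrightarrow> w / r < (real p)\<^sup>2"
        using le_sqrt_iff[of "real p" "w / r"] unfolding a_def by linarith
      also have "\<dots> \<longleftrightarrow> w < r * (real p)\<^sup>2" using r by (simp add: field_simps)
      finally show "a < real p \<longleftrightarrow> w < r * real p ^ 2" .
      show "real p \<le> b \<longleftrightarrow> real p ^ 2 \<le> w" unfolding b_def by (simp add: le_sqrt_iff)
    qed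
    then show ?thesis by auto
  qed
  finally show ?thesis by (simp add: \<phi>_def X_def)
qed

section \<open>Taylor expansion of the kernel\<close>

text \<open>A geometric sum in \<open>z^2\<close> with \<open>n div 2\<close> terms, one for each
  odd \<open>k < n\<close>.\<close>

lemma odd_geometric_sum:
  fixes z :: real
  assumes "1 \<le> n"
  shows "(1 - z\<^sup>2) * (\<Sum>k=1..<n. if odd k then z ^ (k - 1) else 0) = 1 - z ^ (2 * (n div 2))"
  using assms
proof (induction n rule: dec_induct)
  case base
  then show ?case by simp
next
  case (step n)
  show ?case
  proof (cases "odd n")
    case True
    then obtain m where m: "n = 2 * m + 1" by (elim oddE)
    have "(1 - z\<^sup>2) * (\<Sum>k=1..<Suc n. if odd k then z ^ (k - 1) else 0)
        = (1 - z\<^sup>2) * (\<Sum>k=1..<n. if odd k then z ^ (k - 1) else 0) + (1 - z\<^sup>2) * z ^ (n - 1)"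
      using True step.hyps by (simp add: distrib_left)
    also have "\<dots> = 1 - z ^ (2 * m) + (1 - z\<^sup>2) * z ^ (2 * m)" unfolding step.IH by (simp add: m)
    also have "\<dots> = 1 - z ^ (2 * (Suc n div 2))" by (simp add: m algebra_simps power2_eq_square)
    finally show ?thesis .
  next
    case False
    then obtain m where m: "n = 2 * m" by (auto elim: evenE)
    show ?thesis using step by (simp add: m)
  qed
qed

text \<open>The remainder \<open>h\<close> vanishes at 0, and its derivative is the tail of a
  geometric series, between 0 and \<open>8 / 3 * z ^ (n - 1)\<close>. Hence both \<open>h\<close>
  and \<open>8 / 3 * z ^ n - h z\<close> are nondecreasing. The constant is
  \<open>2 / (1 - 1 / 4)\<close>, from \<open>z \<le> 1 / 2\<close>.\<close>

lemma ln_quotient_taylor: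
  fixes z :: real
  assumes z: "0 \<le> z" "z \<le> 1 / 2" and n: "1 \<le> n"
  shows "\<bar>ln (1 + z) - ln (1 - z) - (\<Sum>k=1..<n. if odd k then 2 * z ^ k / k else 0)\<bar> \<le> 8 / 3 * z ^ n"
proof -
  define h where "h z = ln (1 + z) - ln (1 - z) - (\<Sum>k=1..<n. if odd k then 2 * z ^ k / k else 0)" for z :: real
  define h' where "h' z = 2 * z ^ (2 * (n div 2)) / (1 - z\<^sup>2)" for z :: real
  have sq: "y\<^sup>2 \<le> 1 / 4" if "0 \<le> y" "y \<le> 1/2" for y :: real
    using power_mono[of y "1/2" 2] that by (simp add: power2_eq_square)
  have deriv: "(h has_real_derivative h' y) (at y)" if y: "0 \<le> y" "y \<le> 1/2" for y
  proof -
    have d: "((\<lambda>z. if odd k then 2 * z ^ k / real k else 0) has_real_derivative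
             (if odd k then 2 * y ^ (k - 1) else 0)) (at y)" if "k \<in> {1..<n}" for k :: nat
      using that by (cases "odd k") (auto intro!: derivative_eq_intros)
    have "(h has_real_derivative 1 / (1 + y) + 1 / (1 - y) - (\<Sum>k=1..<n. if odd k then 2 * y ^ (k - 1) else 0)) (at y)"
      unfolding h_def [abs_def]
    proof (rule DERIV_diff[OF _ DERIV_sum[OF d]])
      show "((\<lambda>z. ln (1 + z) - ln (1 - z)) has_real_derivative 1 / (1 + y) + 1 / (1 - y)) (at y)"
        using y by (auto intro!: derivative_eq_intros)
    qed
    also have "(\<Sum>k=1..<n. if odd k then 2 * y ^ (k - 1) else 0) = 2 * (\<Sum>k=1..<n. if odd k then y ^ (k - 1) else 0)"
      by (auto simp: sum_distrib_left intro!: sum.cong)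
    also have "(\<Sum>k=1..<n. if odd k then y ^ (k - 1) else 0) = (1 - y ^ (2 * (n div 2))) / (1 - y\<^sup>2)"
      using odd_geometric_sum[OF n, of y] sq[OF y] by (simp add: field_simps)
    also have "1 / (1 + y) + 1 / (1 - y) = 2 / (1 - y\<^sup>2)"
      using y sq[OF y] by (simp add: divide_simps) (simp add: algebra_simps power2_eq_square)
    also have "2 / (1 - y\<^sup>2) - 2 * ((1 - y ^ (2 * (n div 2))) / (1 - y\<^sup>2)) = h' y"
      by (simp add: h'_def diff_divide_distrib algebra_simps)
    finally show ?thesis .
  qed
  have h'_bounds: "0 \<le> h' y" "h' y \<le> 8 / 3 * y ^ (n - 1)" if y: "0 \<le> y" "y \<le> 1/2" for y
  proof -
    \<comment> \<open>The exponent \<open>2 * (n div 2)\<close> is \<open>n\<close> or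
      \<open>n - 1\<close>, and \<open>y \<le> 1\<close>.\<close>
    have "y ^ (2 * (n div 2)) \<le> y ^ (n - 1)" using y n by (intro power_decreasing) auto
    then have "h' y \<le> 2 * y ^ (n - 1) / (3/4)" unfolding h'_def using sq[OF y] y
      by (intro frac_le mult_left_mono) auto
    then show "h' y \<le> 8 / 3 * y ^ (n - 1)" by simp
    show "0 \<le> h' y" using sq[OF y] y by (simp add: h'_def)
  qed
  have h0: "h 0 = 0" by (auto simp: h_def intro!: sum.neutral)
  have "h 0 \<le> h z"
  proof (rule DERIV_nonneg_imp_nondecreasing[OF z(1)])
    fix y assume "0 \<le> y" "y \<le> z"
    then have y: "0 \<le> y" "y \<le> 1/2" using z by auto
    show "\<exists>D. (h has_real_derivative D) (at y) \<and> 0 \<le> D" using deriv[OF y] h'_bounds(1)[OF y] by blast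
  qed
  moreover have "8 / 3 * 0 ^ n - h 0 \<le> 8 / 3 * z ^ n - h z"
  proof (rule DERIV_nonneg_imp_nondecreasing[of 0 z "\<lambda>z. 8 / 3 * z ^ n - h z"])
    fix y assume y: "0 \<le> y" "y \<le> z"
    then have y': "0 \<le> y" "y \<le> 1/2" using z by auto
    have "((\<lambda>z. 8 / 3 * z ^ n - h z) has_real_derivative 8 / 3 * (n * y ^ (n - 1)) - h' y) (at y)"
      by (auto intro!: derivative_eq_intros deriv y')
    moreover have "1 * y ^ (n - 1) \<le> n * y ^ (n - 1)" using n y by (intro mult_right_mono) auto
    then have "0 \<le> 8 / 3 * (n * y ^ (n - 1)) - h' y" using h'_bounds[OF y'] by simp
    ultimately show "\<exists>D. ((\<lambda>z. 8 / 3 * z ^ n - h z) has_real_derivative D) (at y) \<and> 0 \<le> D" by blast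
  qed (use z in auto)
  moreover have "(0::real) ^ n = 0" using n by simp
  ultimately have "\<bar>h z\<bar> \<le> 8 / 3 * z ^ n" using h0 by simp
  then show ?thesis by (simp only: h_def)
qed

section \<open>The coefficients and the derivative of the main term\<close>

lemma a_coeff_nonneg: "1 < r \<Longrightarrow> 0 \<le> a_coeff k r"
  unfolding a_coeff_def by (intro sum_nonneg mult_nonneg_nonneg divide_nonneg_nonneg) auto

lemma a_coeff_0 [simp]: "a_coeff 0 r = 0"
  by (simp add: a_coeff_def)

text \<open>Passing from \<open>n - 1\<close> to \<open>n\<close> multiplies every old summand by
  \<open>n\<close>. A new index \<open>j\<close> appears only for odd \<open>n\<close>, with
  \<open>2 * j - 1 = n\<close>, and there the factorials cancel.\<close>

lemma a_coeff_rec: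
  assumes "1 \<le> n"
  shows "a_coeff n r = n * a_coeff (n - 1) r + (if odd n then 2 * ln r ^ n / n else 0)"
proof (cases "odd n")
  case True
  then obtain m where m: "n = 2 * m + 1" by (elim oddE)
  then have [simp]: "(n + 1) div 2 = Suc m" "n div 2 = m" by auto
  have "n * a_coeff (n - 1) r = (\<Sum>j = 1..m. fact n / fact (2 * j - 1) * (2 * ln r ^ (2 * j - 1) / real (2 * j - 1)))"
    using m by (simp add: a_coeff_def sum_distrib_left mult.assoc flip: times_divide_eq_right)
  then show ?thesis using True by (simp add: a_coeff_def) (simp add: m)
next
  case False
  then obtain m where m: "n = 2 * m" by (auto elim: evenE)
  then obtain l where l: "n = Suc l" using assms not0_implies_Suc[of n] by auto
  have [simp]: "(n + 1) div 2 = m" "n div 2 = m" "Suc l div 2 = m" using m l by auto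
  have "n * a_coeff (n - 1) r = (\<Sum>j = 1..m. fact n / fact (2 * j - 1) * (2 * ln r ^ (2 * j - 1) / real (2 * j - 1)))"
    using l by (simp add: a_coeff_def sum_distrib_left mult.assoc flip: times_divide_eq_right)
  then show ?thesis using False by (simp add: a_coeff_def)
qed

definition main_sum :: "nat \<Rightarrow> real \<Rightarrow> real \<Rightarrow> real" where
  "main_sum n r w = (\<Sum>k = 1..n - 1. a_coeff k r * (w / ln w ^ (k + 1)))"

text \<open>The left side is the derivative of \<open>main_sum\<close> with \<open>X = ln w\<close>.
  By the recurrence, each negative term removes the part \<open>k * a_coeff (k - 1) r\<close> of the
  next coefficient, so only the odd Taylor terms and the last negative term survive.\<close>

lemma a_coeff_telescope:
  fixes X :: real
  assumes "1 \<le> n" "X \<noteq> 0"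
  shows "(\<Sum>k=1..<n. a_coeff k r * (1 / X ^ (k + 1) - real (k + 1) / X ^ (k + 2)))
    = (\<Sum>k=1..<n. (if odd k then 2 * ln r ^ k / k else 0) / X ^ (k + 1)) - n * a_coeff (n - 1) r / X ^ (n + 1)"
  using assms(1)
proof (induction n rule: dec_induct)
  case base
  then show ?case by simp
next
  case (step n)
  have "(\<Sum>k=1..<Suc n. a_coeff k r * (1 / X ^ (k + 1) - real (k + 1) / X ^ (k + 2)))
      = (\<Sum>k=1..<n. (if odd k then 2 * ln r ^ k / k else 0) / X ^ (k + 1)) - n * a_coeff (n - 1) r / X ^ (n + 1)
        + a_coeff n r * (1 / X ^ (n + 1) - real (n + 1) / X ^ (n + 2))"
    using step.hyps by (simp only: sum.atLeastLessThan_Suc step.IH)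
  also have "a_coeff n r * (1 / X ^ (n + 1) - real (n + 1) / X ^ (n + 2)) =
      a_coeff n r / X ^ (n + 1) - real (n + 1) * a_coeff n r / X ^ (n + 2)"
    by (simp add: algebra_simps)
  also have "a_coeff n r / X ^ (n + 1) = n * a_coeff (n - 1) r / X ^ (n + 1)
       + (if odd n then 2 * ln r ^ n / n else 0) / X ^ (n + 1)"
    using a_coeff_rec[OF step.hyps(1), of r] by (simp add: add_divide_distrib)
  finally show ?case using step.hyps by simp
qed

lemma main_sum_has_derivative:
  assumes "1 < w"
  shows "(main_sum n r has_real_derivative
           (\<Sum>k=1..<n. a_coeff k r * (1 / ln w ^ (k + 1) - real (k + 1) / ln w ^ (k + 2)))) (at w within A)"
proof -
  have "((\<lambda>w. a_coeff k r * (w / ln w ^ (k + 1))) has_real_derivative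
          a_coeff k r * (1 / ln w ^ (k + 1) - real (k + 1) / ln w ^ (k + 2))) (at w within A)" for k
  proof -
    have "((\<lambda>w. ln w ^ (k + 1)) has_real_derivative real (k + 1) * ln w ^ k * (1 / w)) (at w within A)"
      using assms DERIV_power[OF DERIV_ln_divide[THEN has_field_derivative_at_within], of w "k + 1" A]
      by (simp add: mult_ac)
    from DERIV_divide[OF DERIV_ident this] have "((\<lambda>w. w / ln w ^ (k + 1)) has_real_derivative
        (1 * ln w ^ (k + 1) - w * (real (k + 1) * ln w ^ k * (1 / w))) / (ln w ^ (k + 1) * ln w ^ (k + 1))) (at w within A)"
      using assms by simp
    also have "(1 * ln w ^ (k + 1) - w * (real (k + 1) * ln w ^ k * (1 / w))) / (ln w ^ (k + 1) * ln w ^ (k + 1))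
       = 1 / ln w ^ (k + 1) - real (k + 1) / ln w ^ (k + 2)"
      using assms by (simp add: divide_simps) (simp add: algebra_simps)
    finally show ?thesis by (rule DERIV_cmult)
  qed
  moreover have "{1..n - 1} = {1..<n}" by auto
  ultimately show ?thesis unfolding main_sum_def [abs_def]
    by (auto intro!: DERIV_sum)
qed

text \<open>With \<open>z = ln r / ln w \<le> 1 / 2\<close> the kernel is
  \<open>(ln (1 + z) - ln (1 - z)) / ln w\<close>. Its odd Taylor terms are those left by the
  telescoping sum, so the error consists of the Taylor remainder and the last telescoping
  term.\<close>

lemma log_kernel_approx:
  assumes n: "1 \<le> n" and r: "1 < r" and w: "1 < w" "ln r \<le> ln w / 2"
  shows "\<bar>log_kernel r w - (\<Sum>k=1..<n. a_coeff k r * (1 / ln w ^ (k + 1) - real (k + 1) / ln w ^ (k + 2)))\<bar>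
     \<le> (n * a_coeff (n - 1) r + 8 / 3 * ln r ^ n) / ln w ^ (n + 1)"
proof -
  define X where "X = ln w"
  define z where "z = ln r / X"
  have X: "0 < X" using w by (simp add: X_def)
  have L: "0 < ln r" using r by simp
  have z: "0 \<le> z" "z \<le> 1 / 2" using X L w by (auto simp: z_def X_def field_simps)
  have a: "0 \<le> a_coeff k r" for k using r by (rule a_coeff_nonneg)
  have "ln (X + ln r) - ln (X - ln r) = ln (1 + z) - ln (1 - z)"
  proof -
    have "X + ln r = X * (1 + z)" "X - ln r = X * (1 - z)" using X by (auto simp: z_def field_simps)
    then show ?thesis using X z by (simp add: ln_mult)
  qed
  then have k: "log_kernel r w = (ln (1 + z) - ln (1 - z)) / X" by (simp add: log_kernel_def X_def)
  have s: "(\<Sum>k=1..<n. (if odd k then 2 * ln r ^ k / k else 0) / X ^ (k + 1))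
      = (\<Sum>k=1..<n. if odd k then 2 * z ^ k / k else 0) / X"
    unfolding sum_divide_distrib by (rule sum.cong) (auto simp: z_def power_divide field_simps)
  have "\<bar>log_kernel r w - (\<Sum>k=1..<n. a_coeff k r * (1 / X ^ (k + 1) - real (k + 1) / X ^ (k + 2)))\<bar>
    = \<bar>(ln (1 + z) - ln (1 - z) - (\<Sum>k=1..<n. if odd k then 2 * z ^ k / k else 0)) / X
        + n * a_coeff (n - 1) r / X ^ (n + 1)\<bar>"
    using X n a_coeff_telescope[of n X r] unfolding s k by (simp add: diff_divide_distrib)
  also have "\<dots> \<le> \<bar>(ln (1 + z) - ln (1 - z) - (\<Sum>k=1..<n. if odd k then 2 * z ^ k / k else 0)) / X\<bar>
        + \<bar>n * a_coeff (n - 1) r / X ^ (n + 1)\<bar>" by (rule abs_triangle_ineq)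
  also have "\<dots> \<le> 8 / 3 * z ^ n / X + n * a_coeff (n - 1) r / X ^ (n + 1)"
  proof (rule add_mono)
    show "\<bar>(ln (1 + z) - ln (1 - z) - (\<Sum>k=1..<n. if odd k then 2 * z ^ k / k else 0)) / X\<bar> \<le> 8 / 3 * z ^ n / X"
      unfolding abs_divide abs_of_pos[OF X]
      by (rule divide_right_mono[OF ln_quotient_taylor[OF z n]]) (use X in simp)
    show "\<bar>n * a_coeff (n - 1) r / X ^ (n + 1)\<bar> \<le> n * a_coeff (n - 1) r / X ^ (n + 1)"
      using X a[of "n - 1"] by simp
  qed
  also have "8 / 3 * z ^ n / X = 8 / 3 * ln r ^ n / X ^ (n + 1)"
    using X by (simp add: z_def power_divide field_simps)
  finally show ?thesis by (simp add: X_def add_divide_distrib add.commute)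
qed

text \<open>Integrates the pointwise approximation, which has antiderivative
  \<open>main_sum n r\<close>. The pointwise bound is largest at the left end \<open>W\<close>, and
  the interval has length at most \<open>x\<close>.\<close>

lemma log_kernel_integral:
  assumes n: "1 \<le> n" and r: "1 < r" and W: "1 < W" "W \<le> x" "ln r \<le> ln W / 2"
  shows "log_kernel r integrable_on {W..x}"
    and "\<bar>integral {W..x} (log_kernel r) - (main_sum n r x - main_sum n r W)\<bar>
      \<le> (n * a_coeff (n - 1) r + 8 / 3 * ln r ^ n) / ln W ^ (n + 1) * x"
proof -
  have L: "0 < ln r" using r by simp
  have lnw: "0 < ln w" "ln W \<le> ln w" "ln r \<le> ln w / 2" if "w \<in> {W..x}" for w
  proof -
    show "0 < ln w" using that W by auto
    show "ln W \<le> ln w" using that W by (subst ln_le_cancel_iff) auto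
    then show "ln r \<le> ln w / 2" using W by simp
  qed
  have "continuous_on {W..x} (log_kernel r)"
    unfolding log_kernel_def [abs_def]
  proof (intro continuous_intros)
    show "\<forall>w\<in>{W..x}. ln w \<noteq> 0" using lnw by fastforce
    show "\<forall>w\<in>{W..x}. ln w + ln r \<noteq> 0" using lnw L by fastforce
    show "\<forall>w\<in>{W..x}. ln w - ln r \<noteq> 0" 
    proof
      fix w assume w: "w \<in> {W..x}"
      show "ln w - ln r \<noteq> 0" using lnw[OF w] by linarith
    qed
  qed (use W in auto)
  then show int: "log_kernel r integrable_on {W..x}" by (rule integrable_continuous_real)
  define B where "B = (n * a_coeff (n - 1) r + 8 / 3 * ln r ^ n) / ln W ^ (n + 1)"
  define P' where "P' w = (\<Sum>k=1..<n. a_coeff k r * (1 / ln w ^ (k + 1) - real (k + 1) / ln w ^ (k + 2)))" for w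
  have a: "0 \<le> a_coeff k r" for k using r by (rule a_coeff_nonneg)
  have B0: "0 \<le> n * a_coeff (n - 1) r + 8 / 3 * ln r ^ n" using a L by simp
  have P': "(P' has_integral (main_sum n r x - main_sum n r W)) {W..x}"
    unfolding P'_def [abs_def] using W
    by (intro fundamental_theorem_of_calculus)
       (use main_sum_has_derivative in \<open>simp_all flip: has_real_derivative_iff_has_vector_derivative del: power_Suc power_add add_2_eq_Suc'\<close>)
  have D: "((\<lambda>w. log_kernel r w - P' w) has_integral 
      (integral {W..x} (log_kernel r) - (main_sum n r x - main_sum n r W))) {W..x}"
    using int by (intro has_integral_diff P') (simp add: has_integral_integral)
  have "norm (integral {W..x} (log_kernel r) - (main_sum n r x - main_sum n r W)) \<le> B * measure lborel (cbox W x)"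
  proof (rule has_integral_bound)
    show "0 \<le> B" using B0 lnw(1)[of W] W by (simp add: B_def)
    show "((\<lambda>w. log_kernel r w - P' w) has_integral 
      (integral {W..x} (log_kernel r) - (main_sum n r x - main_sum n r W))) (cbox W x)" using D by simp
    fix w assume "w \<in> cbox W x"
    then have w: "w \<in> {W..x}" by simp
    have "\<bar>log_kernel r w - P' w\<bar> \<le> (n * a_coeff (n - 1) r + 8 / 3 * ln r ^ n) / ln w ^ (n + 1)"
      unfolding P'_def by (rule log_kernel_approx[OF n r _ lnw(3)[OF w]]) (use W w in auto)
    also have "\<dots> \<le> B" unfolding B_def using B0 lnw[OF w] lnw(1)[of W] W
      by (intro divide_left_mono power_mono mult_pos_pos zero_less_power) auto
    finally show "norm (log_kernel r w - P' w) \<le> B" by simp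
  qed
  also have "\<dots> = B * (x - W)" using W by simp
  also have "\<dots> \<le> B * x" using B0 lnw(1)[of W] W by (intro mult_left_mono) (auto simp: B_def)
  finally show "\<bar>integral {W..x} (log_kernel r) - (main_sum n r x - main_sum n r W)\<bar>
      \<le> (n * a_coeff (n - 1) r + 8 / 3 * ln r ^ n) / ln W ^ (n + 1) * x" by (simp add: B_def)
qed

section \<open>Counting products of two primes\<close>

lemma finite_primes_square_le: "finite {p. p \<in> S \<and> prime p \<and> real p ^ 2 \<le> x}"
proof (rule finite_subset)
  show "{p. p \<in> S \<and> prime p \<and> real p ^ 2 \<le> x} \<subseteq> {..nat \<lfloor>sqrt x\<rfloor>}"
    by (auto intro!: le_nat_floor real_le_rsqrt)
qed simp

lemma card_primes_square_le:
  assumes "0 \<le> x"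
  shows "real (card {p. p \<in> S \<and> prime p \<and> real p ^ 2 \<le> x}) \<le> sqrt x"
proof -
  have "{p. p \<in> S \<and> prime p \<and> real p ^ 2 \<le> x} = {p \<in> S. prime p \<and> real p \<le> sqrt x}"
    using assms by (auto simp: le_sqrt_iff)
  then show ?thesis using prime_count_le[of "sqrt x" S] assms by (simp add: prime_count_def)
qed

text \<open>\<open>D_count\<close> counts products rather than pairs; unique factorization together
  with the order \<open>p < q\<close> makes the two counts agree.\<close>

lemma inj_on_prime_product:
  "inj_on (\<lambda>(p, q). p * q) {(p, q). prime (p::nat) \<and> prime q \<and> p < q}"
proof (rule inj_onI, clarify)
  fix p q p' q' :: nat
  assume *: "prime p" "prime q" "p < q" "prime p'" "prime q'" "p' < q'" "p * q = p' * q'"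
  have "p dvd p' * q'" using *(7) by (metis dvd_triv_left)
  then have "p = p' \<or> p = q'"
    using * by (metis prime_dvd_mult_iff primes_dvd_imp_eq)
  moreover have "p \<noteq> q'"
  proof
    assume "p = q'"
    then have "q = p'" using * by (auto simp: mult.commute prime_gt_0_nat)
    then show False using * \<open>p = q'\<close> by simp
  qed
  ultimately have "p = p'" by simp
  then show "p = p' \<and> q = q'" using * by (auto simp: prime_gt_0_nat)
qed

text \<open>Since \<open>p < q\<close> and \<open>p * q \<le> x\<close> force
  \<open>p^2 \<le> x\<close>, the pairs can be grouped by \<open>p\<close>, and \<open>q\<close>
  then ranges over the primes of \<open>S2\<close> above \<open>p\<close> up to
  \<open>min (r * p) (x / p)\<close>.\<close>

lemma D_count_eq_sum:
  assumes r: "1 < r" and x: "0 \<le> x"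
  shows "real (D_count S1 S2 r x) = (\<Sum>p | p \<in> S1 \<and> prime p \<and> real p ^ 2 \<le> x.
      real (prime_count S2 (min (r * p) (x / p))) - real (prime_count S2 p))"
proof -
  define Q where "Q = {p. p \<in> S1 \<and> prime p \<and> real p ^ 2 \<le> x}"
  define R where "R p = {q \<in> S2. prime q \<and> real p < real q \<and> real q \<le> min (r * p) (x / p)}" for p :: nat
  have finQ: "finite Q" unfolding Q_def by (rule finite_primes_square_le)
  have finR: "finite (R p)" for p
    by (rule finite_subset[of _ "{..nat \<lfloor>r * p\<rfloor>}"]) (auto simp: R_def le_nat_floor)
  have "{p * q | p q. prime p \<and> prime q \<and> p \<in> S1 \<and> q \<in> S2 \<and> p < q \<and> real q \<le> r * real p \<and> real (p * q) \<le> x}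
      = (\<lambda>(p, q). p * q) ` Sigma Q R" (is "?A = ?B")
  proof (intro equalityI subsetI)
    fix m assume "m \<in> ?A"
    then obtain p q where pq: "m = p * q" "prime p" "prime q" "p \<in> S1" "q \<in> S2" "p < q"
      "real q \<le> r * real p" "real (p * q) \<le> x" by blast
    have p0: "0 < real p" using pq by (simp add: prime_gt_0_nat)
    have "real p ^ 2 \<le> real p * real q" using pq p0 by (simp add: power2_eq_square)
    then have "p \<in> Q" using pq by (simp add: Q_def)
    moreover have "q \<in> R p" using pq p0 by (simp add: R_def field_simps)
    ultimately show "m \<in> ?B" using pq by force
  next
    fix m assume "m \<in> ?B"
    then obtain p q where pq: "m = p * q" "p \<in> Q" "q \<in> R p" by auto
    have p0: "0 < real p" using pq by (simp add: Q_def prime_gt_0_nat)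
    have "real (p * q) \<le> x" using pq p0 by (simp add: R_def field_simps)
    then show "m \<in> ?A" using pq unfolding Q_def R_def by auto
  qed
  then have "D_count S1 S2 r x = card (Sigma Q R)"
    unfolding D_count_def
    by (simp, intro card_image inj_on_subset[OF inj_on_prime_product]) (auto simp: Q_def R_def)
  also have "\<dots> = (\<Sum>p\<in>Q. card (R p))" using finQ finR by simp
  finally have "real (D_count S1 S2 r x) = (\<Sum>p\<in>Q. real (card (R p)))" by simp
  also have "\<dots> = (\<Sum>p\<in>Q. real (prime_count S2 (min (r * p) (x / p))) - real (prime_count S2 p))"
  proof (rule sum.cong[OF refl])
    fix p assume p: "p \<in> Q"
    have p0: "0 < real p" using p by (simp add: Q_def prime_gt_0_nat)
    \<comment> \<open>The difference of prime counts is the wanted cardinality once the upper end is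
      at least \<open>p\<close>; this is where \<open>p^2 \<le> x\<close> and \<open>r > 1\<close>
      enter.\<close>
    have "real p \<le> min (r * p) (x / p)"
      using p p0 r by (simp add: Q_def field_simps power2_eq_square)
    then show "real (card (R p)) = real (prime_count S2 (min (r * p) (x / p))) - real (prime_count S2 p)"
      unfolding R_def by (subst prime_count_diff) auto
  qed
  finally show ?thesis by (simp add: Q_def)
qed

text \<open>The trivial bound, for \<open>r\<close> so large that the first error term already
  exceeds \<open>x\<close>.\<close>

lemma D_count_le:
  assumes "0 \<le> x"
  shows "real (D_count S1 S2 r x) \<le> x"
proof -
  have "{p * q | p q. prime p \<and> prime q \<and> p \<in> S1 \<and> q \<in> S2 \<and> p < q \<and> real q \<le> r * real p \<and> real (p * q) \<le> x}
      \<subseteq> {1..nat \<lfloor>x\<rfloor>}"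
    using assms by (auto simp: prime_gt_0_nat Suc_le_eq intro!: le_nat_floor)
  from card_mono[OF _ this] have "D_count S1 S2 r x \<le> nat \<lfloor>x\<rfloor>"
    by (simp add: D_count_def)
  then have "real (D_count S1 S2 r x) \<le> real (nat \<lfloor>x\<rfloor>)" by simp
  also have "\<dots> \<le> x" using assms by (simp add: of_nat_floor)
  finally show ?thesis .
qed

text \<open>Each of the at most \<open>sqrt x\<close> primes \<open>p\<close> brings two errors of
  size \<open>r * damped c (sqrt x)\<close>, the arguments being at most
  \<open>r * p \<le> r * sqrt x\<close>. The product \<open>sqrt x * damped c (sqrt x)\<close> is
  \<open>damped (c / sqrt 2) x\<close>.\<close>

lemma D_count_Li_approx:
  assumes r: "1 < r" and x: "4 \<le> x" and c: "0 \<le> c"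
    and E: "\<And>y. 2 \<le> y \<Longrightarrow> \<bar>real (prime_count S2 y) - d * Li y\<bar> \<le> K * damped c y"
  shows "\<bar>real (D_count S1 S2 r x) - d * (\<Sum>p | p \<in> S1 \<and> prime p \<and> real p ^ 2 \<le> x. Li (min (r * p) (x / p)) - Li p)\<bar>
    \<le> 2 * K * exp (c\<^sup>2 / 4) ^ 2 * r * damped (c / sqrt 2) x"
proof -
  define Q where "Q = {p. p \<in> S1 \<and> prime p \<and> real p ^ 2 \<le> x}"
  define A where "A = exp (c\<^sup>2 / 4)"
  have A: "1 \<le> A" by (simp add: A_def)
  have K: "0 \<le> K" using E by (rule damped_bound_nonneg)
  define \<Delta> where "\<Delta> y = real (prime_count S2 y) - d * Li y" for y
  define T where "T = damped c (sqrt x)"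
  have T0: "0 < T" using x by (simp add: T_def damped_pos)
  have bound: "\<bar>\<Delta> (min (r * p) (x / p)) - \<Delta> p\<bar> \<le> 2 * K * A ^ 2 * r * T" if p: "p \<in> Q" for p
  proof -
    have p2: "2 \<le> real p" using p by (simp add: Q_def prime_ge_2_nat)
    have psq: "real p \<le> sqrt x" using p by (auto simp: Q_def intro: real_le_rsqrt)
    define y where "y = min (r * p) (x / p)"
    have py: "real p \<le> y" using p p2 r by (simp add: y_def Q_def field_simps power2_eq_square)
    have dp: "damped c p \<le> A * T" unfolding A_def T_def using p2 psq by (intro damped_quasi_mono) auto
    \<comment> \<open>Quasi-monotonicity is applied twice, hence \<open>A ^ 2\<close>; in between,
      \<open>damped_scale\<close> takes out the factor \<open>r\<close>.\<close>
    have "damped c y \<le> A * damped c (r * p)"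
      unfolding A_def using p2 py by (intro damped_quasi_mono) (linarith, simp add: y_def)
    also have "\<dots> \<le> A * (r * damped c p)"
      using p2 r c A by (intro mult_left_mono damped_scale) auto
    also have "\<dots> \<le> A * (r * (A * T))"
      using dp A r by (intro mult_left_mono) auto
    finally have dy: "damped c y \<le> A ^ 2 * r * T" by (simp add: power2_eq_square mult_ac)
    have "damped c p \<le> A ^ 2 * r * T"
    proof -
      have "1 * (A * T) \<le> (A * r) * (A * T)"
        using A r T0 mult_mono[of 1 A 1 r] by (intro mult_right_mono) auto
      then show ?thesis using dp by (simp add: power2_eq_square mult_ac)
    qed
    then have "\<bar>\<Delta> p\<bar> \<le> K * (A ^ 2 * r * T)"
      using E[of p] p2 K mult_left_mono[of "damped c p" "A ^ 2 * r * T" K] by (simp add: \<Delta>_def)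
    moreover have "\<bar>\<Delta> y\<bar> \<le> K * (A ^ 2 * r * T)"
      using E[of y] p2 py K mult_left_mono[OF dy, of K] by (simp add: \<Delta>_def)
    ultimately show ?thesis unfolding y_def [symmetric] by (simp add: mult.assoc)
  qed
  have "real (D_count S1 S2 r x) - d * (\<Sum>p\<in>Q. Li (min (r * p) (x / p)) - Li p)
      = (\<Sum>p\<in>Q. \<Delta> (min (r * p) (x / p)) - \<Delta> p)"
    using D_count_eq_sum[OF r, of x S1 S2] x
    by (simp add: Q_def \<Delta>_def sum_distrib_left algebra_simps sum_subtractf sum.distrib)
  also have "\<bar>\<dots>\<bar> \<le> (\<Sum>p\<in>Q. 2 * K * A ^ 2 * r * T)"
    by (rule order_trans[OF sum_abs sum_mono]) (rule bound)
  also have "\<dots> = real (card Q) * (2 * K * A ^ 2 * r * T)" by simp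
  also have "\<dots> \<le> sqrt x * (2 * K * A ^ 2 * r * T)"
    using card_primes_square_le[of x S1] x K r T0 unfolding Q_def by (intro mult_right_mono) auto
  also have "sqrt x * (2 * K * A ^ 2 * r * T) = 2 * K * A ^ 2 * r * damped (c / sqrt 2) x"
    using x by (simp add: T_def damped_def ln_sqrt real_sqrt_divide)
  finally show ?thesis by (simp add: Q_def A_def)
qed

section \<open>The sum of \<open>Li\<close> differences as an integral\<close>

definition kernel_sum :: "nat set \<Rightarrow> real \<Rightarrow> real \<Rightarrow> real" where
  "kernel_sum S r w = (\<Sum>p | p \<in> S \<and> prime p \<and> real p ^ 2 \<le> w \<and> w < r * real p ^ 2. 1 / (p * (ln w - ln p)))"

text \<open>The variable of integration is the product \<open>w = p * u\<close>, where \<open>u\<close> is the variable of \<open>Li\<close>.\<close>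

lemma Li_diff_has_integral:
  assumes r: "1 < r" and p: "prime p" "real p ^ 2 \<le> x"
  shows "((\<lambda>w. if real p ^ 2 \<le> w \<and> w < r * real p ^ 2 then 1 / (p * (ln w - ln p)) else 0) has_integral
     (Li (min (r * p) (x / p)) - Li p)) {4..x}"
proof -
  have p2: "2 \<le> real p" using p by (simp add: prime_ge_2_nat)
  define y where "y = min (r * p) (x / p)"
  have py: "real p \<le> y" using p p2 r by (simp add: y_def field_simps power2_eq_square)
  have yp: "y * p = min (r * real p ^ 2) x"
    using p2 by (simp add: y_def min_def power2_eq_square field_simps)
  have ge4: "4 \<le> real p ^ 2" using power_mono[OF p2, of 2] by simp
  have "((\<lambda>w. 1 / (p * (ln w - ln p))) has_integral (Li (y * p / p) - Li (real p ^ 2 / p))) {real p ^ 2..y * p}"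
  proof (rule fundamental_theorem_of_calculus)
    show "real p ^ 2 \<le> y * p" using py p2 by (simp add: power2_eq_square)
    fix w assume w: "w \<in> {real p ^ 2..y * p}"
    have wp: "w / p \<in> {real p..y}" using w p2 by (simp add: field_simps power2_eq_square)
    have "(Li has_real_derivative 1 / ln (w / p)) (at (w / p) within (\<lambda>w. w / p) ` {real p ^ 2..y * p})"
      by (rule DERIV_subset[OF Li_has_real_derivative[OF p2 wp]])
         (use p2 in \<open>auto simp: field_simps power2_eq_square\<close>)
    moreover have "((\<lambda>w. w / p) has_real_derivative 1 / p) (at w within {real p ^ 2..y * p})"
      using p2 by (auto intro!: derivative_eq_intros)
    ultimately have "(Li \<circ> (\<lambda>w. w / p) has_real_derivative 1 / ln (w / p) * (1 / p)) (at w within {real p ^ 2..y * p})"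
      by (rule DERIV_image_chain)
    moreover have "1 / ln (w / p) * (1 / p) = 1 / (p * (ln w - ln p))"
    proof -
      have "0 < w" using w ge4 by auto
      then show ?thesis using p2 by (simp add: ln_div mult.commute)
    qed
    ultimately have "(Li \<circ> (\<lambda>w. w / p) has_real_derivative 1 / (p * (ln w - ln p))) (at w within {real p ^ 2..y * p})"
      by (simp only:)
    then show "((\<lambda>w. Li (w / p)) has_vector_derivative 1 / (p * (ln w - ln p))) (at w within {real p ^ 2..y * p})"
      by (simp add: has_real_derivative_iff_has_vector_derivative o_def)
  qed
  also have "Li (y * p / p) - Li (real p ^ 2 / p) = Li y - Li p"
    using p2 by (simp add: power2_eq_square)
  finally have "((\<lambda>w. if w \<in> {real p ^ 2..y * p} then 1 / (p * (ln w - ln p)) else 0) has_integral (Li y - Li p)) {4..x}"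
    using ge4 yp by (subst has_integral_restrict) auto
  \<comment> \<open>The strict condition excludes the point \<open>r * p^2\<close>, which the closed
    interval may contain; one point does not change the integral.\<close>
  then have "((\<lambda>w. if real p ^ 2 \<le> w \<and> w < r * real p ^ 2 then 1 / (p * (ln w - ln p)) else 0) has_integral
     (Li y - Li p)) {4..x}"
    by (rule has_integral_spike_finite[of "{r * real p ^ 2}", rotated 2]) (auto simp: yp)
  then show ?thesis by (simp add: y_def)
qed

text \<open>Sum and integral are exchanged over the fixed finite set \<open>p^2 \<le> x\<close>; for
  \<open>w \<le> x\<close> the indicator selects exactly the terms of \<open>kernel_sum\<close>. The
  lower limit 4 is the square of the least prime.\<close>

lemma kernel_sum_has_integral:
  assumes r: "1 < r"
  shows "(kernel_sum S r has_integral
     (\<Sum>p | p \<in> S \<and> prime p \<and> real p ^ 2 \<le> x. Li (min (r * p) (x / p)) - Li p)) {4..x}"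
proof -
  define Q where "Q = {p. p \<in> S \<and> prime p \<and> real p ^ 2 \<le> x}"
  have finQ: "finite Q" unfolding Q_def by (rule finite_primes_square_le)
  have int: "((\<lambda>w. \<Sum>p\<in>Q. if real p ^ 2 \<le> w \<and> w < r * real p ^ 2 then 1 / (p * (ln w - ln p)) else 0) has_integral
     (\<Sum>p\<in>Q. Li (min (r * p) (x / p)) - Li p)) {4..x}"
    using r by (intro has_integral_sum finQ Li_diff_has_integral) (auto simp: Q_def)
  have eq: "(\<Sum>p\<in>Q. if real p ^ 2 \<le> w \<and> w < r * real p ^ 2 then 1 / (p * (ln w - ln p)) else 0)
      = kernel_sum S r w" if "w \<in> {4..x}" for w
  proof -
    have "(\<Sum>p\<in>Q. if real p ^ 2 \<le> w \<and> w < r * real p ^ 2 then 1 / (p * (ln w - ln p)) else 0)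
      = (\<Sum>p\<in>{p\<in>Q. real p ^ 2 \<le> w \<and> w < r * real p ^ 2}. 1 / (p * (ln w - ln p)))"
      by (simp only: sum.inter_filter[OF finQ])
    also have "{p\<in>Q. real p ^ 2 \<le> w \<and> w < r * real p ^ 2}
        = {p. p \<in> S \<and> prime p \<and> real p ^ 2 \<le> w \<and> w < r * real p ^ 2}"
      using that by (auto simp: Q_def)
    finally show ?thesis by (simp add: kernel_sum_def)
  qed
  show ?thesis using has_integral_eq[OF eq int] unfolding Q_def .
qed

text \<open>A crude bound for small \<open>w\<close>:
  \<open>ln w - ln p \<ge> ln p \<ge> 1 / 2\<close> and \<open>p \<ge> 2\<close> make every term at
  most 1, and there are at most \<open>sqrt w\<close> terms.\<close>

lemma kernel_sum_bounds:
  assumes "0 < w"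
  shows "0 \<le> kernel_sum S r w" "kernel_sum S r w \<le> sqrt w"
proof -
  let ?P = "{p. p \<in> S \<and> prime p \<and> real p ^ 2 \<le> w \<and> w < r * real p ^ 2}"
  have term_bounds: "0 \<le> 1 / (p * (ln w - ln p))" "1 / (p * (ln w - ln p)) \<le> 1" if "p \<in> ?P" for p
  proof -
    have p2: "2 \<le> real p" using that by (simp add: prime_ge_2_nat)
    have "ln (real p ^ 2) \<le> ln w" using that p2 assms by (subst ln_le_cancel_iff) auto
    then have 1: "ln p \<le> ln w - ln p" using p2 by (simp add: ln_realpow)
    have "ln 2 \<le> ln p" using p2 by (subst ln_le_cancel_iff) auto
    then have 2: "1 / 2 \<le> ln w - ln p" using 1 ln_2_ge_half by linarith
    have "2 * (1 / 2) \<le> p * (ln w - ln p)" using p2 2 by (intro mult_mono) auto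
    then show "1 / (p * (ln w - ln p)) \<le> 1" by simp
    show "0 \<le> 1 / (p * (ln w - ln p))" using p2 2 by simp
  qed
  show "0 \<le> kernel_sum S r w" unfolding kernel_sum_def by (rule sum_nonneg) (rule term_bounds)
  have "kernel_sum S r w \<le> (\<Sum>p\<in>?P. 1)" unfolding kernel_sum_def by (rule sum_mono) (rule term_bounds)
  also have "\<dots> = real (card ?P)" by simp
  also have "\<dots> \<le> real (card {p. p \<in> S \<and> prime p \<and> real p ^ 2 \<le> w})"
    by (intro of_nat_mono card_mono finite_primes_square_le) auto
  also have "\<dots> \<le> sqrt w" using assms by (intro card_primes_square_le) auto
  finally show "kernel_sum S r w \<le> sqrt w" .
qed

text \<open>On \<open>{4..W}\<close> the crude bound costs \<open>W * sqrt W\<close>. Beyond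
  \<open>W\<close> the pointwise error is a multiple of \<open>damped (c / sqrt 2) w / w\<close>;
  quasi-monotonicity replaces the numerator by its value at \<open>x\<close>, and integrating
  \<open>1 / w\<close> brings in \<open>ln x\<close>.\<close>

lemma kernel_sum_integral_approx:
  assumes r: "1 < r" and c: "0 \<le> c"
    and W: "4 * r \<le> W" "2 \<le> ln W" "W \<le> x" "ln r \<le> ln W / 2"
    and E: "\<And>y. 2 \<le> y \<Longrightarrow> \<bar>real (prime_count S y) - d * Li y\<bar> \<le> K * damped c y"
  shows "\<bar>integral {4..x} (kernel_sum S r) - d * integral {W..x} (log_kernel r)\<bar>
    \<le> W * sqrt W + 2 * K * exp (c\<^sup>2 / 4) * exp ((c / sqrt 2)\<^sup>2 / 4) * (r * damped (c / sqrt 2) x * ln x)"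
proof -
  define c' where "c' = c / sqrt 2"
  define B where "B = 2 * K * exp (c\<^sup>2 / 4)"
  define J where "J = kernel_sum S r"
  have W4: "4 < W" using r W by linarith
  have K: "0 \<le> K" using E by (rule damped_bound_nonneg)
  then have B0: "0 \<le> B" by (simp add: B_def)
  have intJ: "J integrable_on {4..x}"
    unfolding J_def using kernel_sum_has_integral[OF r] by (rule has_integral_integrable)
  have intJ1: "J integrable_on {4..W}" and intJ2: "J integrable_on {W..x}"
    by (rule integrable_on_subinterval[OF intJ]; use W W4 in simp)+
  have split: "integral {4..x} J = integral {4..W} J + integral {W..x} J"
    using W W4 intJ by (intro Henstock_Kurzweil_Integration.integral_combine[symmetric]) auto
  have intG: "log_kernel r integrable_on {W..x}"
    using r W W4 by (intro log_kernel_integral(1)[of 1]) auto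
  have small: "\<bar>integral {4..W} J\<bar> \<le> W * sqrt W"
  proof -
    have "norm (integral {4..W} J) \<le> integral {4..W} (\<lambda>w. sqrt W)"
    proof (rule integral_norm_bound_integral[OF intJ1])
      fix w assume w: "w \<in> {4..W}"
      have "sqrt w \<le> sqrt W" using w by simp
      then have "J w \<le> sqrt W" "0 \<le> J w"
        using kernel_sum_bounds[of w S r] w order_trans[of "J w" "sqrt w" "sqrt W"] unfolding J_def by auto
      then show "norm (J w) \<le> sqrt W" by simp
    qed (intro integrable_continuous_real continuous_on_const)
    also have "\<dots> = (W - 4) * sqrt W" using W4 by simp
    also have "\<dots> \<le> W * sqrt W" using W4 by (intro mult_right_mono) auto
    finally show ?thesis by simp
  qed
  define Z where "Z = B * r * (exp (c'\<^sup>2 / 4) * damped c' x)"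
  have Z0: "0 \<le> Z" using B0 r W W4 by (simp add: Z_def damped_def)
  have inv: "((\<lambda>w. Z * (1 / w)) has_integral Z * (ln x - ln W)) {W..x}"
    using W W4
    by (intro has_integral_mult_right fundamental_theorem_of_calculus)
       (auto simp flip: has_real_derivative_iff_has_vector_derivative intro!: derivative_eq_intros)
  have large: "\<bar>integral {W..x} J - d * integral {W..x} (log_kernel r)\<bar> \<le> Z * ln x"
  proof -
    have "norm (integral {W..x} (\<lambda>w. J w - d * log_kernel r w)) \<le> integral {W..x} (\<lambda>w. Z * (1 / w))"
    proof (rule integral_norm_bound_integral)
      show "(\<lambda>w. J w - d * log_kernel r w) integrable_on {W..x}"
        by (intro integrable_diff intJ2 integrable_on_mult_right intG)
      show "(\<lambda>w. Z * (1 / w)) integrable_on {W..x}" using inv by (rule has_integral_integrable)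
      fix w assume w: "w \<in> {W..x}"
      have lnw: "ln W \<le> ln w" using w W4 by (subst ln_le_cancel_iff) auto
      have "\<bar>J w - d * log_kernel r w\<bar> \<le> 2 * K * exp (c\<^sup>2 / 4) * sqrt r * exp (- (c / sqrt 2) * sqrt (ln w))"
        unfolding J_def kernel_sum_def
        by (rule kernel_sum_bound[OF r _ _ c E]) (use w W lnw in auto)
      also have "\<dots> = B * sqrt r * (damped c' w / w)"
        using w W4 by (simp add: B_def damped_def c'_def)
      also have "\<dots> \<le> B * r * (exp (c'\<^sup>2 / 4) * damped c' x / w)"
      proof (intro mult_mono divide_right_mono damped_quasi_mono)
        show "sqrt r \<le> r" using r by (intro real_le_lsqrt) (auto simp: power2_eq_square)
      qed (use w W4 B0 r in \<open>auto simp: damped_def\<close>)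
      finally show "norm (J w - d * log_kernel r w) \<le> Z * (1 / w)" by (simp add: Z_def)
    qed
    also have "integral {W..x} (\<lambda>w. J w - d * log_kernel r w) = integral {W..x} J - d * integral {W..x} (log_kernel r)"
      using intJ2 intG by (subst Henstock_Kurzweil_Integration.integral_diff) (auto intro: integrable_on_mult_right)
    also have "integral {W..x} (\<lambda>w. Z * (1 / w)) = Z * (ln x - ln W)" using inv by (rule integral_unique)
    also have "\<dots> \<le> Z * ln x" using Z0 W by (intro mult_left_mono) auto
    finally show ?thesis by simp
  qed
  have "\<bar>integral {4..x} J - d * integral {W..x} (log_kernel r)\<bar> \<le> W * sqrt W + Z * ln x"
    using small large unfolding split by linarith
  then show ?thesis by (simp add: J_def Z_def B_def c'_def mult_ac)
qed

section \<open>Estimates uniform in the ratio\<close>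

text \<open>As \<open>ln (exp 1) = 1\<close>, the value at \<open>exp 1\<close> is the sum of the
  coefficients of \<open>a_coeff k r\<close> as a polynomial in \<open>ln r\<close>.\<close>

lemma a_coeff_le:
  assumes "\<And>i. 1 \<le> i \<Longrightarrow> i \<le> k \<Longrightarrow> ln r ^ i \<le> T"
  shows "a_coeff k r \<le> a_coeff k (exp 1) * T"
  unfolding a_coeff_def sum_distrib_right
proof (rule sum_mono)
  fix j assume j: "j \<in> {1..(k + 1) div 2}"
  have "fact k / fact (2 * j - 1) * (2 * ln r ^ (2 * j - 1) / real (2 * j - 1))
      \<le> fact k / fact (2 * j - 1) * (2 * T / real (2 * j - 1))"
    using j by (intro mult_left_mono divide_right_mono assms) auto
  then show "fact k / fact (2 * j - 1) * (2 * ln r ^ (2 * j - 1) / real (2 * j - 1))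
     \<le> fact k / fact (2 * j - 1) * (2 * ln (exp 1) ^ (2 * j - 1) / real (2 * j - 1)) * T"
    by simp
qed

lemma a_coeff_le_power:
  assumes "1 < r"
  shows "a_coeff k r \<le> a_coeff k (exp 1) * (1 + ln r) ^ k"
proof (rule a_coeff_le)
  fix i assume i: "1 \<le> i" "i \<le> k"
  have "ln r ^ i \<le> (1 + ln r) ^ i" using assms by (intro power_mono) auto
  also have "\<dots> \<le> (1 + ln r) ^ k" using assms i by (intro power_increasing) auto
  finally show "ln r ^ i \<le> (1 + ln r) ^ k" .
qed

text \<open>The quantity \<open>ln (2 * r) / ln 2\<close> is at least 1 and at least
  \<open>ln r\<close>, so its powers can be raised even for \<open>r\<close> near 1. The remaining
  factor \<open>ln r\<close> preserves the decay as \<open>r\<close> tends to 1.\<close>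

lemma ln_power_le:
  fixes r :: real
  assumes r: "1 < r" and i: "1 \<le> i" "i \<le> m + 1"
  shows "ln r ^ i \<le> ln r * (ln (2 * r) / ln 2) ^ m"
proof -
  obtain l where l: "i = Suc l" "l \<le> m" using i by (cases i) auto
  have 0: "0 < ln r" using r by simp
  have ln2: "0 < ln (2::real)" "ln (2::real) \<le> 1" using ln_2_less_1 by auto
  have eq: "ln (2 * r) = ln 2 + ln r" using r by (simp add: ln_mult)
  have "ln r * 1 \<le> ln r * (1 / ln 2)" using 0 ln2 by (intro mult_left_mono) auto
  then have le: "ln r \<le> ln (2 * r) / ln 2" using ln2 by (simp add: eq add_divide_distrib)
  have "ln r ^ l \<le> (ln (2 * r) / ln 2) ^ l" using 0 le by (intro power_mono) auto
  also have "\<dots> \<le> (ln (2 * r) / ln 2) ^ m"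
    using l 0 ln2 by (intro power_increasing) (auto simp: eq)
  finally show ?thesis using 0 l by simp
qed

lemma power_le_fact_exp:
  fixes y :: real
  assumes "0 \<le> y"
  shows "y ^ k \<le> fact k * exp y"
proof -
  have "(\<Sum>i\<in>{k}. y ^ i /\<^sub>R fact i) \<le> (\<Sum>i. y ^ i /\<^sub>R fact i)"
    using assms by (intro sum_le_suminf) (auto simp: summable_exp_generic scaleR_nonneg_nonneg simp del: real_scaleR_def)
  then show ?thesis by (simp add: exp_def field_simps)
qed

text \<open>Put \<open>u = c * sqrt (ln x)\<close> and \<open>ln r = u + v\<close> with
  \<open>v \<ge> 0\<close>. Then \<open>1 + ln r \<le> (1 + u) * (1 + v)\<close>, where
  \<open>1 + u \<le> ln x\<close> cancels the denominator except for one \<open>ln x\<close>, and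
  \<open>(1 + v) ^ k \<le> fact k * exp (1 + v)\<close>. The product \<open>x * exp v\<close> is
  \<open>r * damped c x\<close>, and the spare \<open>ln x\<close> absorbs \<open>A\<close>.\<close>

lemma main_sum_bound_large_ratio:
  assumes c: "0 < c"
  shows "\<forall>\<^sub>F x in at_top. \<forall>r>1. exp (c * sqrt (ln x)) \<le> r \<longrightarrow> \<bar>main_sum n r x\<bar> \<le> r * damped c x"
proof -
  define A where "A = (\<Sum>k=1..n - 1. a_coeff k (exp 1) * (exp 1 * fact k))"
  have "\<forall>\<^sub>F x::real in at_top. 1 < x" by (rule eventually_gt_at_top)
  moreover have "\<forall>\<^sub>F x::real in at_top. 1 + c * sqrt (ln x) \<le> ln x" using c by real_asymp
  moreover have "\<forall>\<^sub>F x::real in at_top. A / ln x \<le> 1"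
  proof -
    have "((\<lambda>x::real. A / ln x) \<longlongrightarrow> 0) at_top" by real_asymp
    then have "\<forall>\<^sub>F x in at_top. A / ln x < 1" by (rule order_tendstoD) simp
    then show ?thesis by (rule eventually_mono) simp
  qed
  ultimately show ?thesis
  proof eventually_elim
    case (elim x)
    show ?case
    proof (intro allI impI)
      fix r :: real assume r: "1 < r" "exp (c * sqrt (ln x)) \<le> r"
      define X where "X = ln x"
      define u where "u = c * sqrt X"
      define v where "v = ln r - u"
      have X: "0 < X" using elim by (simp add: X_def)
      have u: "0 \<le> u" "1 + u \<le> X" using elim c by (auto simp: u_def X_def)
      have v: "0 \<le> v" using r ln_ge_iff[of r u] by (simp add: v_def u_def X_def)
      have term_le: "a_coeff k r * (x / X ^ (k + 1)) \<le> a_coeff k (exp 1) * (exp 1 * fact k) * (x * exp v / X)" for k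
      proof -
        have "(1 + u) * (1 + v) = 1 + ln r + u * v" by (simp add: v_def algebra_simps)
        moreover have "0 \<le> u * v" using u v by simp
        ultimately have "(1 + ln r) ^ k \<le> ((1 + u) * (1 + v)) ^ k"
          using r by (intro power_mono) auto
        also have "\<dots> = (1 + u) ^ k * (1 + v) ^ k" by (simp add: power_mult_distrib)
        also have "\<dots> \<le> X ^ k * (fact k * exp (1 + v))"
          using u v power_le_fact_exp[of "1 + v" k] by (intro mult_mono power_mono) auto
        finally have 1: "(1 + ln r) ^ k \<le> X ^ k * (fact k * exp (1 + v))" .
        have "a_coeff k r \<le> a_coeff k (exp 1) * (1 + ln r) ^ k" using r by (intro a_coeff_le_power)
        also have "\<dots> \<le> a_coeff k (exp 1) * (X ^ k * (fact k * exp (1 + v)))"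
          using 1 by (intro mult_left_mono a_coeff_nonneg) auto
        finally have "a_coeff k r * (x / X ^ (k + 1))
            \<le> a_coeff k (exp 1) * (X ^ k * (fact k * exp (1 + v))) * (x / X ^ (k + 1))"
          using elim X by (intro mult_right_mono) auto
        also have "\<dots> = a_coeff k (exp 1) * (exp 1 * fact k) * (x * exp v / X)"
          using X by (simp add: exp_add)
        finally show ?thesis .
      qed
      have "main_sum n r x \<le> (\<Sum>k=1..n - 1. a_coeff k (exp 1) * (exp 1 * fact k) * (x * exp v / X))"
        unfolding main_sum_def X_def [symmetric] by (intro sum_mono term_le)
      also have "\<dots> = A / X * (x * exp v)" by (simp add: A_def sum_distrib_right sum_divide_distrib)
      also have "\<dots> \<le> 1 * (x * exp v)" using elim by (intro mult_right_mono) (auto simp: X_def)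
      also have "x * exp v = r * damped c x"
        using r by (simp add: v_def u_def X_def damped_def exp_diff exp_minus field_simps)
      finally have "main_sum n r x \<le> r * damped c x" by simp
      moreover have "0 \<le> main_sum n r x"
        unfolding main_sum_def using r elim by (intro sum_nonneg mult_nonneg_nonneg a_coeff_nonneg) auto
      ultimately show "\<bar>main_sum n r x\<bar> \<le> r * damped c x" by simp
    qed
  qed
qed

text \<open>Disposes of the boundary term at \<open>W\<close>. Both 1 and \<open>ln r\<close> are at
  most \<open>ln W / 2\<close>, so \<open>1 + ln r \<le> ln W\<close> and the denominators absorb
  the coefficients.\<close>

lemma main_sum_le_linear:
  assumes r: "1 < r" and W: "1 < W" "2 \<le> ln W" "ln r \<le> ln W / 2"
  shows "\<bar>main_sum n r W\<bar> \<le> (\<Sum>k=1..n - 1. a_coeff k (exp 1)) * W"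
proof -
  have "a_coeff k r * (W / ln W ^ (k + 1)) \<le> a_coeff k (exp 1) * W" for k
  proof -
    have "(1 + ln r) ^ k \<le> ln W ^ k" using W r by (intro power_mono) auto
    also have "\<dots> \<le> ln W ^ (k + 1)" using W by (intro power_increasing) auto
    finally have 1: "(1 + ln r) ^ k \<le> ln W ^ (k + 1)" .
    have "a_coeff k r \<le> a_coeff k (exp 1) * (1 + ln r) ^ k" using r by (intro a_coeff_le_power)
    also have "\<dots> \<le> a_coeff k (exp 1) * ln W ^ (k + 1)"
      using 1 by (intro mult_left_mono a_coeff_nonneg) auto
    finally have "a_coeff k r * (W / ln W ^ (k + 1)) \<le> a_coeff k (exp 1) * ln W ^ (k + 1) * (W / ln W ^ (k + 1))"
      using W by (intro mult_right_mono) auto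
    then show ?thesis using W by simp
  qed
  then have "main_sum n r W \<le> (\<Sum>k=1..n - 1. a_coeff k (exp 1)) * W"
    unfolding main_sum_def sum_distrib_right by (intro sum_mono)
  moreover have "0 \<le> main_sum n r W"
    unfolding main_sum_def using r W by (intro sum_nonneg mult_nonneg_nonneg a_coeff_nonneg) auto
  ultimately show ?thesis by simp
qed

text \<open>The second implied constant. \<open>2 ^ (n + 1)\<close> stems from
  \<open>ln (sqrt x) = ln x / 2\<close>, the term with \<open>a_coeff\<close> from the end of the
  telescoping sum, \<open>8 / 3\<close> from the Taylor remainder, and the power of
  \<open>ln 2\<close> from \<open>ln_power_le\<close>.\<close>

definition tail_constant :: "nat \<Rightarrow> real" where
  "tail_constant n = 2 ^ (n + 1) * (n * a_coeff (n - 1) (exp 1) + 8 / 3) / ln 2 ^ (2 * (n div 2) + 1)"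

lemma tail_bound:
  assumes n: "1 \<le> n" and r: "1 < r" and x: "1 < x"
  shows "(n * a_coeff (n - 1) r + 8 / 3 * ln r ^ n) / ln (sqrt x) ^ (n + 1) * x
    \<le> tail_constant n * (x * ln (2 * r) ^ (2 * (n div 2) + 1) * ln r / ln x ^ (n + 1))"
proof -
  define m where "m = 2 * (n div 2) + 1"
  define T where "T = ln r * (ln (2 * r) / ln 2) ^ m"
  have nm: "n \<le> m + 1" by (simp add: m_def)
  have "a_coeff (n - 1) r \<le> a_coeff (n - 1) (exp 1) * T"
    unfolding T_def using r nm by (intro a_coeff_le ln_power_le) auto
  then have "n * a_coeff (n - 1) r + 8 / 3 * ln r ^ n \<le> n * (a_coeff (n - 1) (exp 1) * T) + 8 / 3 * T"
    unfolding T_def using r nm n by (intro add_mono mult_left_mono ln_power_le) auto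
  also have "\<dots> = (n * a_coeff (n - 1) (exp 1) + 8 / 3) * T" by (simp add: algebra_simps)
  finally have "(n * a_coeff (n - 1) r + 8 / 3 * ln r ^ n) / ln (sqrt x) ^ (n + 1) * x
      \<le> (n * a_coeff (n - 1) (exp 1) + 8 / 3) * T / ln (sqrt x) ^ (n + 1) * x"
    using x by (intro mult_right_mono divide_right_mono) auto
  also have "\<dots> = tail_constant n * (x * ln (2 * r) ^ m * ln r / ln x ^ (n + 1))"
    using x unfolding tail_constant_def m_def[symmetric]
    by (simp add: T_def ln_sqrt power_divide mult_ac)
  finally show ?thesis by (simp add: m_def)
qed

lemma tail_constant_nonneg: "0 \<le> tail_constant n"
  using a_coeff_nonneg[of "exp 1" "n - 1"] by (simp add: tail_constant_def)

section \<open>Combining the estimates\<close>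

text \<open>\<open>C1\<close> is fixed before \<open>n\<close>, and the threshold for
  \<open>x\<close> may depend on \<open>n\<close> but not on \<open>r\<close>. This uniformity comes
  from the split at \<open>r = exp (a * sqrt (ln x))\<close>: above it trivial bounds suffice, below
  it the conditions on \<open>r\<close> follow from conditions on \<open>x\<close>.\<close>

lemma D_count_asymptotics:
  assumes \<delta>: "0 < \<delta>1" "0 < \<delta>2" and c: "0 < c" and \<epsilon>: "0 < \<epsilon>" "\<epsilon> < 1"
    and E1: "(\<lambda>x. real (prime_count S1 x) - 1 / \<delta>1 * Li x) \<in> O(\<lambda>x. x * exp (- c * sqrt (ln x)))"
    and E2: "(\<lambda>x. real (prime_count S2 x) - 1 / \<delta>2 * Li x) \<in> O(\<lambda>x. x * exp (- c * sqrt (ln x)))"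
  shows "\<exists>C1. \<forall>n\<ge>1. \<forall>\<^sub>F x in at_top. \<forall>r>1.
      \<bar>\<delta>1 * \<delta>2 * real (D_count S1 S2 r x) - main_sum n r x\<bar>
      \<le> C1 * (r * damped ((1 - \<epsilon>) * c / sqrt 2) x)
        + tail_constant n * (x * ln (2 * r) ^ (2 * (n div 2) + 1) * ln r / ln x ^ (n + 1))"
proof -
  obtain K1 where K1: "0 < K1" "\<And>y. 2 \<le> y \<Longrightarrow> \<bar>real (prime_count S1 y) - 1 / \<delta>1 * Li y\<bar> \<le> K1 * damped c y"
    using prime_count_error_bound[OF E1] by blast
  obtain K2 where K2: "0 < K2" "\<And>y. 2 \<le> y \<Longrightarrow> \<bar>real (prime_count S2 y) - 1 / \<delta>2 * Li y\<bar> \<le> K2 * damped c y"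
    using prime_count_error_bound[OF E2] by blast
  define b where "b = c / sqrt 2"
  define a where "a = (1 - \<epsilon>) * c / sqrt 2"
  have a0: "0 < a" using c \<epsilon> by (simp add: a_def)
  have "(1 - \<epsilon>) * b < 1 * b" using c \<epsilon> by (intro mult_strict_right_mono) (auto simp: b_def)
  then have ab: "a < b" by (simp add: a_def b_def)
  define Ca where "Ca = 2 * K2 * exp (c\<^sup>2 / 4) ^ 2"
  define Cb where "Cb = 2 * K1 * exp (c\<^sup>2 / 4) * exp ((c / sqrt 2)\<^sup>2 / 4)"
  have C0: "0 \<le> Ca" "0 \<le> Cb" using K1 K2 by (auto simp: Ca_def Cb_def)
  \<comment> \<open>The parts with \<open>Ca\<close> and \<open>Cb\<close> pay for the two
    approximations, the last 1 for the boundary term at \<open>W\<close>; the extra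
    \<open>\<delta>1 * \<delta>2\<close> covers large \<open>r\<close>.\<close>
  define C1 where "C1 = \<delta>1 * \<delta>2 * (Ca + 1) + \<delta>1 * (1 + Cb) + 1"
  have C1_ge: "\<delta>1 * \<delta>2 + 1 \<le> C1" using \<delta> C0 by (simp add: C1_def distrib_left)
  have "\<forall>\<^sub>F x in at_top. \<forall>r>1.
      \<bar>\<delta>1 * \<delta>2 * real (D_count S1 S2 r x) - main_sum n r x\<bar>
      \<le> C1 * (r * damped a x)
        + tail_constant n * (x * ln (2 * r) ^ (2 * (n div 2) + 1) * ln r / ln x ^ (n + 1))"
    if n: "1 \<le> n" for n
  proof -
    define A where "A = (\<Sum>k=1..n - 1. a_coeff k (exp 1))"
    have A0: "0 \<le> A" unfolding A_def by (intro sum_nonneg a_coeff_nonneg) auto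
    have "\<forall>\<^sub>F x::real in at_top. 16 < x" by (rule eventually_gt_at_top)
    moreover note main_sum_bound_large_ratio[OF a0, of n]
    moreover have "\<forall>\<^sub>F x::real in at_top. 4 * exp (a * sqrt (ln x)) \<le> sqrt x" using a0 by real_asymp
    moreover have "\<forall>\<^sub>F x::real in at_top. 4 \<le> ln x" by real_asymp
    moreover have "\<forall>\<^sub>F x::real in at_top. a * sqrt (ln x) \<le> ln x / 4" using a0 by real_asymp
    moreover have "\<forall>\<^sub>F x::real in at_top. sqrt x * sqrt (sqrt x) \<le> damped a x"
      unfolding damped_def using a0 by real_asymp
    moreover have "\<forall>\<^sub>F x::real in at_top. (A + 1) * sqrt x \<le> damped a x"
      unfolding damped_def using a0 A0 by real_asymp
    \<comment> \<open>The purpose of \<open>\<epsilon>\<close>: the gap \<open>a < b\<close> pays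
      for the factor \<open>ln x\<close> from integrating \<open>1 / w\<close>.\<close>
    moreover have "\<forall>\<^sub>F x::real in at_top. damped b x * ln x \<le> damped a x"
    proof -
      define e where "e = b - a"
      have e: "0 < e" "b = a + e" using ab by (auto simp: e_def)
      have "\<forall>\<^sub>F x::real in at_top. exp (- e * sqrt (ln x)) * ln x \<le> 1" using e(1) by real_asymp
      with eventually_gt_at_top[of 1] show ?thesis
      proof eventually_elim
        case (elim x)
        have "damped b x * ln x = damped a x * (exp (- e * sqrt (ln x)) * ln x)"
          by (simp add: damped_def e(2) algebra_simps flip: exp_add)
        also have "\<dots> \<le> damped a x * 1" using elim by (intro mult_left_mono) (auto simp: damped_def)
        finally show ?case by simp
      qed
    qed
    ultimately show ?thesis
    proof eventually_elim
      case (elim x)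
      show ?case
      proof (intro allI impI)
        fix r :: real assume r: "1 < r"
        define D where "D = real (D_count S1 S2 r x)"
        define err where "err = tail_constant n * (x * ln (2 * r) ^ (2 * (n div 2) + 1) * ln r / ln x ^ (n + 1))"
        have err0: "0 \<le> err" unfolding err_def using elim r tail_constant_nonneg
          by (intro mult_nonneg_nonneg divide_nonneg_nonneg) auto
        have da0: "0 < damped a x" using elim by (intro damped_pos) auto
        have "\<bar>\<delta>1 * \<delta>2 * D - main_sum n r x\<bar> \<le> C1 * (r * damped a x) + err"
        proof (cases "exp (a * sqrt (ln x)) \<le> r")
          case True
          have "\<bar>main_sum n r x\<bar> \<le> r * damped a x" using elim r True by blast
          moreover have "\<bar>\<delta>1 * \<delta>2 * D\<bar> \<le> \<delta>1 * \<delta>2 * (r * damped a x)"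
          proof -
            have "D \<le> x" unfolding D_def using elim by (intro D_count_le) auto
            \<comment> \<open>For such \<open>r\<close> the first error term alone exceeds
              \<open>x\<close>.\<close>
            also have "x = exp (a * sqrt (ln x)) * damped a x" by (simp add: damped_def exp_minus)
            also have "\<dots> \<le> r * damped a x" using True da0 by (intro mult_right_mono) auto
            finally show ?thesis using \<delta> by (simp add: abs_mult D_def)
          qed
          ultimately have "\<bar>\<delta>1 * \<delta>2 * D - main_sum n r x\<bar> \<le> (\<delta>1 * \<delta>2 + 1) * (r * damped a x)"
            by (simp add: distrib_right)
          also have "\<dots> \<le> C1 * (r * damped a x)" using C1_ge r da0 by (intro mult_right_mono) auto
          finally show ?thesis using err0 by simp
        next
          case False
          then have r_less: "r < exp (a * sqrt (ln x))" by simp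
          \<comment> \<open>A cut at \<open>sqrt x\<close> makes \<open>W * sqrt W = x^(3/4)\<close>
            negligible, while \<open>ln W\<close> stays comparable to \<open>ln x\<close> and
            \<open>W\<close> exceeds \<open>4 * r\<close>.\<close>
          define W where "W = sqrt x"
          have lnW: "ln W = ln x / 2" using elim by (simp add: W_def ln_sqrt)
          have "ln r < a * sqrt (ln x)" using r_less r by (metis ln_exp ln_less_cancel_iff exp_gt_zero less_trans zero_less_one)
          then have Wr: "ln r \<le> ln W / 2" using elim lnW by simp
          have W4r: "4 * r \<le> W" using elim r_less by (simp add: W_def)
          have W2: "2 \<le> ln W" using elim lnW by simp
          have Wx: "W \<le> x" unfolding W_def using elim by (intro real_le_lsqrt) (auto simp: power2_eq_square)
          have W1: "1 < W" using W4r r by linarith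
          define R where "R = r * damped a x"
          have Ra: "damped a x \<le> R" using r da0 by (simp add: R_def)
          define SL where "SL = (\<Sum>p | p \<in> S1 \<and> prime p \<and> real p ^ 2 \<le> x. Li (min (r * p) (x / p)) - Li p)"
          define G where "G = integral {W..x} (log_kernel r)"
          have SL: "integral {4..x} (kernel_sum S1 r) = SL"
            unfolding SL_def using kernel_sum_has_integral[OF r] by (rule integral_unique)
          have db: "damped b x * ln x \<le> damped a x" using elim by blast
          have "0 < damped b x" using elim by (intro damped_pos) auto
          then have "damped b x * 1 \<le> damped b x * ln x" using elim by (intro mult_left_mono) auto
          with db have db': "damped b x \<le> damped a x" by simp
          have "\<bar>D - 1 / \<delta>2 * SL\<bar> \<le> Ca * r * damped b x"
            unfolding D_def SL_def Ca_def b_def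
            by (rule D_count_Li_approx[OF r _ _ K2(2)]) (use elim c in auto)
          also have "\<dots> \<le> Ca * r * damped a x" using C0 r db' by (intro mult_left_mono) auto
          finally have 1: "\<bar>D - 1 / \<delta>2 * SL\<bar> \<le> Ca * R" by (simp add: R_def mult.assoc)
          have "\<bar>SL - 1 / \<delta>1 * G\<bar> \<le> W * sqrt W + Cb * (r * damped b x * ln x)"
            unfolding SL[symmetric] G_def Cb_def b_def
            by (rule kernel_sum_integral_approx[OF r _ W4r W2 Wx Wr K1(2)]) (use c in auto)
          also have "W * sqrt W \<le> R" using elim Ra by (simp add: W_def)
          also have "Cb * (r * damped b x * ln x) \<le> Cb * R"
            using C0 r db by (intro mult_left_mono) (auto simp: R_def mult.assoc)
          finally have 2: "\<bar>SL - 1 / \<delta>1 * G\<bar> \<le> (1 + Cb) * R" by (simp add: distrib_right)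
          have "\<bar>G - (main_sum n r x - main_sum n r W)\<bar>
              \<le> (n * a_coeff (n - 1) r + 8 / 3 * ln r ^ n) / ln W ^ (n + 1) * x"
            unfolding G_def by (rule log_kernel_integral(2)[OF n r W1 Wx Wr])
          also have "\<dots> \<le> err" unfolding err_def W_def using n r elim by (intro tail_bound) auto
          finally have 3: "\<bar>G - (main_sum n r x - main_sum n r W)\<bar> \<le> err" .
          have "\<bar>main_sum n r W\<bar> \<le> A * W" unfolding A_def by (rule main_sum_le_linear[OF r W1 W2 Wr])
          also have "\<dots> \<le> (A + 1) * W" using W1 by (intro mult_right_mono) auto
          also have "\<dots> \<le> R" using elim Ra by (simp add: W_def)
          finally have 4: "\<bar>main_sum n r W\<bar> \<le> R" .
          \<comment> \<open>Four errors: \<open>prime_count\<close> to \<open>Li\<close> for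
            \<open>q\<close>, partial summation over \<open>p\<close>, expansion of the kernel, and
            the lower boundary term.\<close>
          have "\<delta>1 * \<delta>2 * D - main_sum n r x = \<delta>1 * \<delta>2 * (D - 1 / \<delta>2 * SL) + \<delta>1 * (SL - 1 / \<delta>1 * G)
              + (G - (main_sum n r x - main_sum n r W)) - main_sum n r W"
            using \<delta> by (simp add: algebra_simps)
          moreover have "\<bar>\<delta>1 * \<delta>2 * (D - 1 / \<delta>2 * SL)\<bar> \<le> \<delta>1 * \<delta>2 * (Ca * R)"
            using 1 \<delta> unfolding abs_mult by simp
          moreover have "\<bar>\<delta>1 * (SL - 1 / \<delta>1 * G)\<bar> \<le> \<delta>1 * ((1 + Cb) * R)"
            using 2 \<delta> unfolding abs_mult by simp
          moreover have "\<bar>s + t + u - v\<bar> \<le> s' + t' + u' + v'"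
            if "\<bar>s\<bar> \<le> s'" "\<bar>t\<bar> \<le> t'" "\<bar>u\<bar> \<le> u'" "\<bar>v\<bar> \<le> v'" for s t u v s' t' u' v' :: real
            using that by linarith
          ultimately have "\<bar>\<delta>1 * \<delta>2 * D - main_sum n r x\<bar>
              \<le> \<delta>1 * \<delta>2 * (Ca * R) + \<delta>1 * ((1 + Cb) * R) + err + R"
            using 3 4 by (simp only:)
          also have "\<dots> = (\<delta>1 * \<delta>2 * Ca + \<delta>1 * (1 + Cb) + 1) * R + err" by (simp add: algebra_simps)
          also have "\<dots> \<le> C1 * R + err"
            using \<delta> Ra da0 by (intro add_right_mono mult_right_mono) (auto simp: C1_def algebra_simps)
          finally show ?thesis by (simp add: R_def)
        qed
        then show "\<bar>\<delta>1 * \<delta>2 * real (D_count S1 S2 r x) - main_sum n r x\<bar>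
            \<le> C1 * (r * damped a x)
              + tail_constant n * (x * ln (2 * r) ^ (2 * (n div 2) + 1) * ln r / ln x ^ (n + 1))"
          by (simp add: D_def err_def)
      qed
    qed
  qed
  then show ?thesis unfolding a_def by blast
qed

theorem theorem4:
  "\<exists>C2 :: nat \<Rightarrow> real. \<forall>(S1 :: nat set) (S2 :: nat set) (\<delta>1 :: real) (\<delta>2 :: real) (c :: real) (\<epsilon> :: real).
     (\<forall>p\<in>S1. prime p) \<longrightarrow> (\<forall>p\<in>S2. prime p) \<longrightarrow>
     \<delta>1 > 0 \<longrightarrow> \<delta>2 > 0 \<longrightarrow> c > 0 \<longrightarrow> 0 < \<epsilon> \<longrightarrow> \<epsilon> < 1 \<longrightarrow>
     (\<lambda>x :: real. real (prime_count S1 x) - 1 / \<delta>1 * Li x) \<in> O(\<lambda>x. x * exp (- c * sqrt (ln x))) \<longrightarrow>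
     (\<lambda>x :: real. real (prime_count S2 x) - 1 / \<delta>2 * Li x) \<in> O(\<lambda>x. x * exp (- c * sqrt (ln x))) \<longrightarrow>
     (\<exists>C1 :: real. \<forall>n\<ge>2. \<forall>\<^sub>F x :: real in at_top. \<forall>r>1.
        \<bar>\<delta>1 * \<delta>2 * real (D_count S1 S2 r x) - (\<Sum>k = 1..n - 1. a_coeff k r * (x / ln x ^ (k + 1)))\<bar>
        \<le> C1 * (r * x * exp (- ((1 - \<epsilon>) * c / sqrt 2) * sqrt (ln x)))
          + C2 n * (x * ln (2 * r) ^ (2 * (n div 2) + 1) * ln r / ln x ^ (n + 1)))"
\<comment> \<open>\<open>tail_constant\<close> is a function of \<open>n\<close> alone, so it can be
  supplied before the prime sets are chosen.\<close>
proof (intro exI[of _ tail_constant] allI impI)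
  fix S1 S2 :: "nat set" and \<delta>1 \<delta>2 c \<epsilon> :: real
  assume "\<delta>1 > 0" "\<delta>2 > 0" "c > 0" "0 < \<epsilon>" "\<epsilon> < 1"
    and "(\<lambda>x :: real. real (prime_count S1 x) - 1 / \<delta>1 * Li x) \<in> O(\<lambda>x. x * exp (- c * sqrt (ln x)))"
    and "(\<lambda>x :: real. real (prime_count S2 x) - 1 / \<delta>2 * Li x) \<in> O(\<lambda>x. x * exp (- c * sqrt (ln x)))"
  from D_count_asymptotics[OF this] obtain C1 where C1:
    "\<And>n. 1 \<le> n \<Longrightarrow> \<forall>\<^sub>F x in at_top. \<forall>r>1.
      \<bar>\<delta>1 * \<delta>2 * real (D_count S1 S2 r x) - main_sum n r x\<bar>
      \<le> C1 * (r * damped ((1 - \<epsilon>) * c / sqrt 2) x)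
        + tail_constant n * (x * ln (2 * r) ^ (2 * (n div 2) + 1) * ln r / ln x ^ (n + 1))"
    by blast
  show "\<exists>C1 :: real. \<forall>n\<ge>2. \<forall>\<^sub>F x :: real in at_top. \<forall>r>1.
        \<bar>\<delta>1 * \<delta>2 * real (D_count S1 S2 r x) - (\<Sum>k = 1..n - 1. a_coeff k r * (x / ln x ^ (k + 1)))\<bar>
        \<le> C1 * (r * x * exp (- ((1 - \<epsilon>) * c / sqrt 2) * sqrt (ln x)))
          + tail_constant n * (x * ln (2 * r) ^ (2 * (n div 2) + 1) * ln r / ln x ^ (n + 1))"
  proof (intro exI[of _ C1] allI impI)
    fix n :: nat assume "2 \<le> n"
    then have "1 \<le> n" by simp
    from C1[OF this] show "\<forall>\<^sub>F x :: real in at_top. \<forall>r>1.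
        \<bar>\<delta>1 * \<delta>2 * real (D_count S1 S2 r x) - (\<Sum>k = 1..n - 1. a_coeff k r * (x / ln x ^ (k + 1)))\<bar>
        \<le> C1 * (r * x * exp (- ((1 - \<epsilon>) * c / sqrt 2) * sqrt (ln x)))
          + tail_constant n * (x * ln (2 * r) ^ (2 * (n div 2) + 1) * ln r / ln x ^ (n + 1))"
      unfolding main_sum_def damped_def mult.assoc .
  qed
qed

end
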